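(* The marked Poisson measure $\pi_{\tilde\sigma}$ on $\Omega_X^M$ is quasi-invariant with respect to the group $\mathfrak A$, and for every $a=(\psi,\eta)\in\mathfrak A$ $$\frac{d(a^*\pi_{\tilde\sigma})}{d\pi_{\tilde\sigma}}(\omega)=\prod_{(x,m)\in\omega}p_a^{\tilde\sigma}(x,m)\qquad\text{for }\pi_{\tilde\sigma}\text{-a.e. }\omega\in\Omega_X^M,$$ where $p_a^{\tilde\sigma}=\frac{d(a^*\tilde\sigma)}{d\tilde\sigma}$ is the Radon–Nikodym density on $X\times M$.
   Context: Setting. $X$ is a connected, oriented, non-compact $C^\infty$ Riemannian manifold with Riemannian volume $\nu$. $M$ is a connected oriented $C^\infty$ Riemannian manifold that is a homogeneous space of a Lie group $G$, i.e. there is a $C^\infty$ transitive left action $\theta:G\times M\to M$; put $\theta_g=\theta(g,\cdot)$ and let $e$ be the unit of $G$. For a measurable map $\phi$, $\phi^*\mu:=\mu\circ\phi^{-1}$ denotes the image (push-forward) measure. $\lambda$ is a fixed Radon measure on $M$, quasi-invariant under all $\theta_g$, such that $p^\lambda(g,m):=\frac{d\theta_g^*\lambda}{d\lambda}(m)$ is differentiable on $G\times M$. The measure $\tilde\sigma$ on $X\times M$ is $\tilde\sigma(dx,dm)=q(x,m)\,\nu(dx)\lambda(dm)$, $q(x,m)=\rho(x)p(x,m)$, where $\rho>0$ $\nu$-a.e., $\sigma=\rho\,\nu$ is a nonatomic Radon measure on $X$, and for $\nu$-a.a. $x$, $p(x,\cdot)>0$ $\lambda$-a.e. and $p(x,m)\lambda(dm)$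 is a finite measure; moreover $\tilde\sigma(X\times M)=\infty$ and $\tilde\sigma(\Lambda\times M)<\infty$ for every Borel $\Lambda\subset X$ with compact closure. Marked configurations. $\Omega_X^M$ is the set of all $\omega\subset X\times M$ such that distinct points of $\omega$ have distinct $X$-coordinates and the projection of $\omega$ to $X$ is locally finite (finitely many points in each compact). Let $\mathcal B_c(X\times M)$ be the family of Borel sets in $X\times M$ whose projection to $X$ is Borel with compact closure. $\mathcal B(\Omega_X^M)$ is the smallest $\sigma$-algebra making all $\omega\mapsto\#(\omega\cap B)$, $B\in\mathcal B_c(X\times M)$, measurable. For a function $f$ write $\langle f,\omega\rangle=\sum_{(x,m)\in\omega}f(x,m)$. $\pi_{\tilde\sigma}$ is the marked Poisson measure with Lévy measure $\tilde\sigma$: the probability measure on $\Omega_X^M$ determined by $\int e^{\langle f,\omega\rangle}\pi_{\tilde\sigma}(d\omega)=\exp\big(\int_{X\times M}(e^{f}-1)\,d\tilde\sigma\big)$ for all bounded continuous $f$ on $X\times M$ with $\operatorname{supp}f\in\mathcal B_c(X\times M)$. Group. $\operatorname{Diff}_0(X)$ is the group of diffeomorphisms of $X$ equal to the identity outside a compact set. $G^X$ is the group (pointwise multiplication) of $C^\infty$ maps $\eta:X\to G$ equal to $e$ outside a compact set. $\mathfrak A$ is the semidirect product: the set $\operatorname{Diff}_0(X)\times G^X$ with $(\psi_1,\eta_1)(\psi_2,\eta_2)=(\psi_1\circ\psi_2,\eta_1(\eta_2\circ\psi_1^{-1}))$. It acts on $X\times M$ by $a(x,m)=(\psi(x),\theta(\eta(\psi(x)),m))$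 for $a=(\psi,\eta)$, and on $\Omega_X^M$ by $a(\omega)=\{a(x,m):(x,m)\in\omega\}$. The measure $\tilde\sigma$ is quasi-invariant under $\mathfrak A$, and $p_a^{\tilde\sigma}$ is taken to be equal to $1$ outside $K\times M$ for a compact $K\subset X$ (depending on $a$) outside which $\psi=\mathrm{id}$ and $\eta=e$; hence only finitely many factors of the product differ from $1$. *)

theory Defs
  imports "HOL-Probability.Probability" "HOL-Algebra.Group_Action"
begin

subsection \<open>Smooth maps between normed spaces\<close>

text \<open>Intended for open \<open>S\<close> in a finite-dimensional space, where \<open>C\<^sup>n\<close> regularity is equivalent to
  continuity of all iterated directional derivatives of order at most \<open>n\<close>.\<close>

fun ck_on :: "nat \<Rightarrow> 'a::real_normed_vector set \<Rightarrow> ('a \<Rightarrow> 'b::real_normed_vector) \<Rightarrow> bool" where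
  "ck_on 0 S f \<longleftrightarrow> continuous_on S f"
| "ck_on (Suc n) S f \<longleftrightarrow> (\<forall>x\<in>S. f differentiable (at x)) \<and>
     (\<forall>v. ck_on n S (\<lambda>x. frechet_derivative f (at x) v))"

definition smooth_on :: "'a::real_normed_vector set \<Rightarrow> ('a \<Rightarrow> 'b::real_normed_vector) \<Rightarrow> bool" where
  "smooth_on S f \<longleftrightarrow> (\<forall>n. ck_on n S f)"


subsection \<open>Smooth manifolds\<close>

text \<open>A manifold is a whole type; its smooth structure is given by an atlas. A chart is a pair of its
  domain and its coordinate map. The model space is a finite-dimensional normed space (such spaces are
  exactly the Heine-Borel normed spaces) rather than a \<open>euclidean_space\<close>, because the latter class
  excludes dimension 0.\<close>

type_synonym ('x, 'e) chart = "'x set \<times> ('x \<Rightarrow> 'e)"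

definition chart_inv :: "('x, 'e) chart \<Rightarrow> 'e \<Rightarrow> 'x" where
  "chart_inv c = inv_into (fst c) (snd c)"

definition transition :: "('x, 'e) chart \<Rightarrow> ('x, 'f) chart \<Rightarrow> 'e \<Rightarrow> 'f" where
  "transition c d = snd d \<circ> chart_inv c"

definition is_chart :: "('x::topological_space, 'e::real_normed_vector) chart \<Rightarrow> bool" where
  "is_chart c \<longleftrightarrow> open (fst c) \<and> open (snd c ` fst c) \<and>
     homeomorphism (fst c) (snd c ` fst c) (snd c) (chart_inv c)"

definition smooth_atlas :: "('x::topological_space, 'e::real_normed_vector) chart set \<Rightarrow> bool" where
  "smooth_atlas A \<longleftrightarrow>
     (\<exists>B::'e set. finite B \<and> span B = UNIV) \<and>
     (\<forall>c\<in>A. is_chart c) \<and> (\<Union>c\<in>A. fst c) = UNIV \<and>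
     (\<forall>c\<in>A. \<forall>d\<in>A. smooth_on (snd c ` (fst c \<inter> fst d)) (transition c d))"

definition prod_atlas ::
  "('x, 'e) chart set \<Rightarrow> ('y, 'f) chart set \<Rightarrow> ('x \<times> 'y, 'e \<times> 'f) chart set" where
  "prod_atlas A B = {(fst c \<times> fst d, map_prod (snd c) (snd d)) | c d. c \<in> A \<and> d \<in> B}"

definition smooth_map ::
  "('x::topological_space, 'e::real_normed_vector) chart set \<Rightarrow>
   ('y::topological_space, 'f::real_normed_vector) chart set \<Rightarrow> ('x \<Rightarrow> 'y) \<Rightarrow> bool" where
  "smooth_map A B f \<longleftrightarrow> continuous_on UNIV f \<and>
     (\<forall>c\<in>A. \<forall>d\<in>B. smooth_on (snd c ` (fst c \<inter> f -` fst d)) (snd d \<circ> f \<circ> chart_inv c))"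

definition differentiable_function ::
  "('x, 'e::real_normed_vector) chart set \<Rightarrow> ('x \<Rightarrow> real) \<Rightarrow> bool" where
  "differentiable_function A f \<longleftrightarrow>
     (\<forall>c\<in>A. \<forall>x\<in>fst c. (f \<circ> chart_inv c) differentiable (at (snd c x)))"

text \<open>The determinant of an endomorphism does not depend on the chosen basis; the value is 1 in
  dimension 0.\<close>

definition linear_det :: "('e::real_vector \<Rightarrow> 'e) \<Rightarrow> real" where
  "linear_det L = (let B = (SOME B. independent B \<and> span B = UNIV) in
     \<Sum>p | p permutes B. of_int (sign p) * (\<Prod>b\<in>B. representation B (L b) (p b)))"

text \<open>An orientation is encoded by an atlas all of whose transition maps have positive Jacobian.\<close>

definition oriented_atlas :: "('x::topological_space, 'e::real_normed_vector) chart set \<Rightarrow> bool" where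
  "oriented_atlas A \<longleftrightarrow> smooth_atlas A \<and>
     (\<forall>c\<in>A. \<forall>d\<in>A. \<forall>x\<in>fst c \<inter> fst d.
        0 < linear_det (frechet_derivative (transition c d) (at (snd c x))))"

text \<open>\<open>g c y v w\<close> is the value at the coordinate point \<open>y\<close> of the local representation, in the
  chart \<open>c\<close>, of a symmetric positive definite covariant 2-tensor field.\<close>

definition riemannian_metric ::
  "('x::topological_space, 'e::real_normed_vector) chart set \<Rightarrow>
   (('x, 'e) chart \<Rightarrow> 'e \<Rightarrow> 'e \<Rightarrow> 'e \<Rightarrow> real) \<Rightarrow> bool" where
  "riemannian_metric A g \<longleftrightarrow>
     (\<forall>c\<in>A. \<forall>y\<in>snd c ` fst c. bilinear (g c y) \<and> (\<forall>v w. g c y v w = g c y w v) \<and>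
        (\<forall>v. v \<noteq> 0 \<longrightarrow> 0 < g c y v v)) \<and>
     (\<forall>c\<in>A. \<forall>v w. smooth_on (snd c ` fst c) (\<lambda>y. g c y v w)) \<and>
     (\<forall>c\<in>A. \<forall>d\<in>A. \<forall>x\<in>fst c \<inter> fst d. \<forall>v w.
        (let D = frechet_derivative (transition c d) (at (snd c x)) in
           g c (snd c x) v w = g d (snd d x) (D v) (D w)))"

text \<open>Hausdorff and second countability are expressed by the sorts of the carrier types.\<close>

definition connected_oriented_riemannian_manifold ::
  "('x::{t2_space, second_countable_topology}, 'e::real_normed_vector) chart set \<Rightarrow>
   (('x, 'e) chart \<Rightarrow> 'e \<Rightarrow> 'e \<Rightarrow> 'e \<Rightarrow> real) \<Rightarrow> bool" where
  "connected_oriented_riemannian_manifold A g \<longleftrightarrow>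
     connected (UNIV :: 'x set) \<and> oriented_atlas A \<and> riemannian_metric A g"

text \<open>In every chart the Riemannian volume has Lebesgue density \<open>sqrt (det g\<^sub>i\<^sub>j)\<close>; this determines
  the measure.\<close>

definition riemannian_volume ::
  "('x::topological_space, real ^ 'n) chart set \<Rightarrow>
   (('x, real ^ 'n) chart \<Rightarrow> real ^ 'n \<Rightarrow> real ^ 'n \<Rightarrow> real ^ 'n \<Rightarrow> real) \<Rightarrow> 'x measure \<Rightarrow> bool" where
  "riemannian_volume A g \<nu> \<longleftrightarrow> sets \<nu> = sets borel \<and>
     (\<forall>c\<in>A. \<forall>B\<in>sets borel. B \<subseteq> fst c \<longrightarrow>
        emeasure \<nu> B =
          (\<integral>\<^sup>+y\<in>snd c ` B. ennreal (sqrt (det (\<chi> i j. g c y (axis i 1) (axis j 1)))) \<partial>lborel))"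


subsection \<open>Lie groups and homogeneous spaces\<close>

definition lie_group :: "'g::t2_space monoid \<Rightarrow> ('g, 'h::real_normed_vector) chart set \<Rightarrow> bool" where
  "lie_group G A \<longleftrightarrow> group G \<and> carrier G = UNIV \<and> smooth_atlas A \<and>
     smooth_map (prod_atlas A A) A (\<lambda>(g, h). g \<otimes>\<^bsub>G\<^esub> h) \<and> smooth_map A A (\<lambda>g. m_inv G g)"

definition homogeneous_space ::
  "'g::t2_space monoid \<Rightarrow> ('g, 'h::real_normed_vector) chart set \<Rightarrow>
   ('m::topological_space, 'f::real_normed_vector) chart set \<Rightarrow> ('g \<Rightarrow> 'm \<Rightarrow> 'm) \<Rightarrow> bool" where
  "homogeneous_space G AG AM \<theta> \<longleftrightarrow> lie_group G AG \<and> smooth_atlas AM \<and>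
     transitive_action G UNIV \<theta> \<and>
     smooth_map (prod_atlas AG AM) AM (\<lambda>(g, m). \<theta> g m)"


subsection \<open>Measures\<close>

definition radon_measure :: "'x::topological_space measure \<Rightarrow> bool" where
  "radon_measure \<mu> \<longleftrightarrow> sets \<mu> = sets borel \<and>
     (\<forall>K. compact K \<longrightarrow> emeasure \<mu> K < \<infinity>) \<and>
     (\<forall>B\<in>sets borel. emeasure \<mu> B = (SUP K\<in>{K. compact K \<and> K \<subseteq> B}. emeasure \<mu> K))"

definition nonatomic :: "'x measure \<Rightarrow> bool" where
  "nonatomic \<mu> \<longleftrightarrow> \<not> (\<exists>A\<in>sets \<mu>. 0 < emeasure \<mu> A \<and>
     (\<forall>B\<in>sets \<mu>. B \<subseteq> A \<longrightarrow> emeasure \<mu> B < emeasure \<mu> A \<longrightarrow> emeasure \<mu> B = 0))"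

definition quasi_invariant :: "('g, 'r) monoid_scheme \<Rightarrow> ('g \<Rightarrow> 'z \<Rightarrow> 'z) \<Rightarrow> 'z measure \<Rightarrow> bool" where
  "quasi_invariant G T \<mu> \<longleftrightarrow> (\<forall>a\<in>carrier G. T a \<in> \<mu> \<rightarrow>\<^sub>M \<mu> \<and>
     absolutely_continuous \<mu> (distr \<mu> \<mu> (T a)) \<and> absolutely_continuous (distr \<mu> \<mu> (T a)) \<mu>)"

text \<open>\<open>f\<close> is a version of the density \<open>d\<kappa>/d\<mu>\<close>.\<close>

definition rn_version :: "'z measure \<Rightarrow> 'z measure \<Rightarrow> ('z \<Rightarrow> ennreal) \<Rightarrow> bool" where
  "rn_version \<mu> \<kappa> f \<longleftrightarrow> f \<in> borel_measurable \<mu> \<and> (AE z in \<mu>. f z = RN_deriv \<mu> \<kappa> z)"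


subsection \<open>Marked configurations and the marked Poisson measure\<close>

definition marked_configurations :: "('x::topological_space \<times> 'm) set set" where
  "marked_configurations =
     {\<omega>. inj_on fst \<omega> \<and> (\<forall>K. compact K \<longrightarrow> finite (fst ` \<omega> \<inter> K))}"

definition borel_c :: "('x::topological_space \<times> 'm::topological_space) set set" where
  "borel_c = {B \<in> sets borel. fst ` B \<in> sets borel \<and> compact (closure (fst ` B))}"

definition configuration_algebra ::
  "('x::topological_space \<times> 'm::topological_space) set measure" where
  "configuration_algebra = sigma marked_configurations
     {(\<lambda>\<omega>. card (\<omega> \<inter> B)) -` N \<inter> marked_configurations | B N. B \<in> borel_c}"

definition test_function :: "('x::topological_space \<times> 'm::topological_space \<Rightarrow> real) \<Rightarrow> bool" where
  "test_function f \<longleftrightarrow> continuous_on UNIV f \<and> bounded (range f) \<and>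
     closure {z. f z \<noteq> 0} \<in> borel_c"

text \<open>For test functions the sum over \<open>\<omega>\<close> has finitely many nonzero terms. A Bochner integral of a
  non-integrable function is 0, so integrability of the exponential is part of the condition.\<close>

definition marked_poisson_measure ::
  "('x::topological_space \<times> 'm::topological_space) measure \<Rightarrow> ('x \<times> 'm) set measure \<Rightarrow> bool" where
  "marked_poisson_measure \<sigma> \<pi> \<longleftrightarrow> prob_space \<pi> \<and> sets \<pi> = sets configuration_algebra \<and>
     (\<forall>f. test_function f \<longrightarrow>
        (\<integral>\<omega>. exp (\<Sum>\<^sub>\<infinity>z\<in>\<omega>. f z) \<partial>\<pi>) = exp (\<integral>z. (exp (f z) - 1) \<partial>\<sigma>))"


subsection \<open>The semidirect product of diffeomorphisms and gauge maps\<close>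

definition diff0 :: "('x::topological_space, 'e::real_normed_vector) chart set \<Rightarrow> ('x \<Rightarrow> 'x) set" where
  "diff0 A = {\<psi>. bij \<psi> \<and> smooth_map A A \<psi> \<and> smooth_map A A (inv_into UNIV \<psi>) \<and>
     (\<exists>K. compact K \<and> (\<forall>x. x \<notin> K \<longrightarrow> \<psi> x = x))}"

definition gauge_maps ::
  "('x::topological_space, 'e::real_normed_vector) chart set \<Rightarrow> 'g::t2_space monoid \<Rightarrow>
   ('g, 'h::real_normed_vector) chart set \<Rightarrow> ('x \<Rightarrow> 'g) set" where
  "gauge_maps A G AG = {\<eta>. smooth_map A AG \<eta> \<and>
     (\<exists>K. compact K \<and> (\<forall>x. x \<notin> K \<longrightarrow> \<eta> x = \<one>\<^bsub>G\<^esub>))}"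

definition semidirect_group ::
  "('x::topological_space, 'e::real_normed_vector) chart set \<Rightarrow> 'g::t2_space monoid \<Rightarrow>
   ('g, 'h::real_normed_vector) chart set \<Rightarrow> (('x \<Rightarrow> 'x) \<times> ('x \<Rightarrow> 'g)) monoid" where
  "semidirect_group A G AG =
     \<lparr>carrier = diff0 A \<times> gauge_maps A G AG,
      mult = (\<lambda>(\<psi>1, \<eta>1) (\<psi>2, \<eta>2).
        (\<psi>1 \<circ> \<psi>2, \<lambda>x. \<eta>1 x \<otimes>\<^bsub>G\<^esub> \<eta>2 (inv_into UNIV \<psi>1 x))),
      one = (id, \<lambda>_. \<one>\<^bsub>G\<^esub>)\<rparr>"

definition point_action ::
  "('g \<Rightarrow> 'm \<Rightarrow> 'm) \<Rightarrow> ('x \<Rightarrow> 'x) \<times> ('x \<Rightarrow> 'g) \<Rightarrow> 'x \<times> 'm \<Rightarrow> 'x \<times> 'm" where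
  "point_action \<theta> = (\<lambda>(\<psi>, \<eta>) (x, m). (\<psi> x, \<theta> (\<eta> (\<psi> x)) m))"

definition configuration_action ::
  "('g \<Rightarrow> 'm \<Rightarrow> 'm) \<Rightarrow> ('x \<Rightarrow> 'x) \<times> ('x \<Rightarrow> 'g) \<Rightarrow> ('x \<times> 'm) set \<Rightarrow> ('x \<times> 'm) set" where
  "configuration_action \<theta> a \<omega> = point_action \<theta> a ` \<omega>"

end

theory Submission
  imports Defs
begin

text \<open>The Laplace functional, given for continuous test functions, extends by dominated convergence to
  all measurable multiplicative functionals, so that
  \<open>\<integral> (\<Prod>z\<in>\<omega>. u z) d\<pi> = exp (\<integral> (u - 1) d\<sigma>)\<close> whenever \<open>u \<ge> 0\<close> equals 1 outside a cylinder \<open>U \<times> M\<close> over a relatively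
  compact \<open>U\<close> and \<open>u - 1\<close> is integrable. The choice \<open>u = p\<^sub>a 1\<^bsub>-B\<^esub>\<close> shows that the image of \<open>\<pi>\<close> and the measure
  with density \<open>\<Prod>z\<in>\<omega>. p\<^sub>a z\<close> give the event \<open>\<omega> \<inter> B = {}\<close> the same mass \<open>exp (- \<sigma> (a\<^sup>-\<^sup>1 B))\<close>; no
  normalisation is left over because \<open>a\<close> maps \<open>U \<times> M\<close> onto itself for large \<open>U\<close>. These void events are
  stable under intersection and, configurations being simple, generate the \<open>\<sigma>\<close>-algebra
  (Renyi's theorem).\<close>

section \<open>Locally compact second countable spaces and pointwise limits\<close>

text \<open>Quasi-invariance of \<sigma> under the group is not among the hypotheses but is derived:
  diffeomorphisms preserve the null sets of the Riemannian volume, since differentiable coordinate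
  maps preserve Lebesgue-null sets; the maps \<open>\<theta> g\<close> preserve those of
  \<open>lam\<close>; a Fubini argument on fibres combines the two. Two features of the density
  shape the extension of the Laplace functional. It may be unbounded, so products are truncated from
  above, and after multiplication with an indicator it vanishes on a set, so logarithms need a
  truncation from below. The limits are taken by monotone convergence and by dominated convergence
  under exp (c N), where N is the number of points in a cylinder; the integrability of this bound
  has to be proved first. Densities are determined only up to null sets. The points where the
  density is infinite or 0 form null sets inside one cylinder, and almost no configuration meets
  such a set. Absence of infinite values yields the product formula, absence of zeros the mutual
  absolute continuity.\<close>

lemma compact_closure_mono:
  fixes A :: "'a::t2_space set"
  assumes "compact (closure B)" "A \<subseteq> B"
  shows "compact (closure A)"
  using assms by (metis closed_closure closure_mono compact_Int_closed inf.absorb2)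

lemma compact_relatively_compact_nbhd:
  fixes K :: "'a::t2_space set"
  assumes lc: "locally_compact_space (euclidean :: 'a topology)" and K: "compact K"
  obtains U where "open U" "compact (closure U)" "K \<subseteq> U"
proof -
  have "\<exists>V C. open V \<and> compact C \<and> x \<in> V \<and> V \<subseteq> C" for x :: 'a
    using lc by (auto simp: locally_compact_space_def)
  then obtain V C where VC: "\<And>x :: 'a. open (V x)" "\<And>x. compact (C x)" "\<And>x. x \<in> V x"
    "\<And>x. V x \<subseteq> C x"
    by metis
  obtain T where T: "T \<subseteq> K" "finite T" "K \<subseteq> (\<Union>x\<in>T. V x)"
    using compactE_image[OF K, of K V] VC(1,3) by blast
  have "compact (\<Union>x\<in>T. C x)"
    using T VC by (intro compact_UN) auto
  then have "compact (closure (\<Union>x\<in>T. C x))"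
    by (simp add: compact_imp_closed)
  then have "compact (closure (\<Union>x\<in>T. V x))"
    by (rule compact_closure_mono) (use VC(4) in auto)
  then show thesis
    using T VC by (intro that[of "\<Union>x\<in>T. V x"]) auto
qed

lemma relatively_compact_open_cover:
  assumes lc: "locally_compact_space (euclidean :: 'a::{t2_space, second_countable_topology} topology)"
  shows "\<exists>U :: nat \<Rightarrow> 'a set. (\<forall>n. open (U n) \<and> compact (closure (U n))) \<and> (\<Union>n. U n) = UNIV"
proof -
  let ?F = "{U :: 'a set. open U \<and> compact (closure U)}"
  obtain F where F: "F \<subseteq> ?F" "countable F" "\<Union>F = \<Union>?F"
    using Lindelof[of ?F] by auto
  have "x \<in> \<Union>?F" for x
    by (rule compact_relatively_compact_nbhd[OF lc, of "{x}"]) auto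
  then have U: "\<Union>F = UNIV"
    using F by auto
  then have "F \<noteq> {}" by auto
  then show ?thesis
    using F U range_from_nat_into[OF _ F(2)] from_nat_into[of F]
    by (intro exI[of _ "from_nat_into F"]) auto
qed

text \<open>The projection of a Borel set need not be Borel, but here a closed set is a countable
  union of compact sets, which have compact projections. This brings supports of continuous
  functions into \<open>borel_c\<close>.\<close>

lemma borel_fst_image_closed:
  fixes S :: "('a::{t2_space, second_countable_topology} \<times> 'b::{t2_space, second_countable_topology}) set"
  assumes lcA: "locally_compact_space (euclidean :: 'a topology)"
    and lcB: "locally_compact_space (euclidean :: 'b topology)" and S: "closed S"
  shows "fst ` S \<in> sets borel"
proof -
  obtain U :: "nat \<Rightarrow> 'a set" where U: "\<And>n. compact (closure (U n))" "(\<Union>n. U n) = UNIV"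
    using relatively_compact_open_cover[OF lcA] by auto
  obtain V :: "nat \<Rightarrow> 'b set" where V: "\<And>n. compact (closure (V n))" "(\<Union>n. V n) = UNIV"
    using relatively_compact_open_cover[OF lcB] by auto
  have 1: "\<exists>n. x \<in> closure (U n)" for x using U(2) closure_subset by blast
  have 2: "\<exists>n. x \<in> closure (V n)" for x using V(2) closure_subset by blast
  have "S = (\<Union>i. \<Union>j. S \<inter> closure (U i) \<times> closure (V j))"
    using 1 2 by auto
  then have "fst ` S = (\<Union>i. \<Union>j. fst ` (S \<inter> closure (U i) \<times> closure (V j)))"
    by (metis (no_types, lifting) SUP_cong image_UN)
  moreover have "compact (fst ` (S \<inter> closure (U i) \<times> closure (V j)))" for i j
    using U V S by (intro compact_continuous_image continuous_intros closed_Int_compact compact_Times)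
  ultimately show ?thesis
    by (simp only:) (intro sets.countable_UN image_subsetI borel_compact)
qed

text \<open>The spaces carry no chosen metric, so bump functions are taken from complete regularity,
  one for each point of \<open>O'\<close>. By the Lindelof property the positivity sets of countably
  many of them already cover \<open>O'\<close>.\<close>

lemma indicator_open_limit:
  fixes O' :: "'a::{t2_space, second_countable_topology} set"
  assumes lc: "locally_compact_space (euclidean :: 'a topology)" and "open O'"
  obtains h :: "nat \<Rightarrow> 'a \<Rightarrow> real" where "\<And>n. continuous_on UNIV (h n)"
    "\<And>n z. 0 \<le> h n z" "\<And>n z. h n z \<le> 1" "\<And>n z. z \<notin> O' \<Longrightarrow> h n z = 0"
    "\<And>z. (\<lambda>n. h n z) \<longlonglongrightarrow> indicator O' z"
proof (cases "O' = {}")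
  case True
  then show ?thesis by (intro that[of "\<lambda>_ _. 0"]) auto
next
  case False
  have "Hausdorff_space (euclidean :: 'a topology)"
    using hausdorff by (auto simp: Hausdorff_space_def disjnt_def)
  then have "completely_regular_space (euclidean :: 'a topology)"
    using lc locally_compact_regular_imp_completely_regular_space by blast
  have "\<exists>f::'a\<Rightarrow>real. continuous_on UNIV f \<and> (\<forall>z. 0 \<le> f z) \<and> f x = 1 \<and> (\<forall>z. z \<notin> O' \<longrightarrow> f z = 0)"
    if "x \<in> O'" for x
  proof -
    have "closedin euclidean (- O')" "x \<in> topspace euclidean - (- O')"
      using \<open>open O'\<close> that by auto
    then obtain g :: "'a \<Rightarrow> real" where g: "continuous_map euclidean (top_of_set {0..1}) g" "g x = 0"
      "g ` (- O') \<subseteq> {1}"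
      using \<open>completely_regular_space euclidean\<close> unfolding completely_regular_space_def by blast
    have "continuous_on UNIV g" "\<And>z. g z \<le> 1"
      using g(1) by (auto simp: continuous_map_in_subtopology image_subset_iff)
    with g show ?thesis
      by (intro exI[of _ "\<lambda>z. 1 - g z"]) (auto intro!: continuous_intros)
  qed
  then obtain f where f: "\<And>x. x \<in> O' \<Longrightarrow> continuous_on UNIV (f x :: 'a \<Rightarrow> real)"
    "\<And>x z. x \<in> O' \<Longrightarrow> 0 \<le> f x z" "\<And>x. x \<in> O' \<Longrightarrow> f x x = 1" "\<And>x z. x \<in> O' \<Longrightarrow> z \<notin> O' \<Longrightarrow> f x z = 0"
    by metis
  let ?V = "\<lambda>x. {z. 0 < f x z}"
  have opn: "open (?V x)" if "x \<in> O'" for x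
    using f(1)[OF that] by (intro open_Collect_less) auto
  obtain F where F: "F \<subseteq> ?V ` O'" "countable F" "\<Union>F = \<Union>(?V ` O')"
    using Lindelof[of "?V ` O'"] opn by auto
  obtain T where T: "T \<subseteq> O'" "countable T" "F = ?V ` T"
    using F(1,2) by (metis (no_types, lifting) countable_subset_image)
  have cov: "\<exists>x\<in>T. 0 < f x z" if "z \<in> O'" for z
  proof -
    have "z \<in> \<Union>(?V ` O')" using f(3)[OF that] that by force
    then show ?thesis using F(3) T(3) by auto
  qed
  with False have "T \<noteq> {}" by blast
  define t where "t = from_nat_into T"
  have t: "t i \<in> O'" for i
    using T(1) from_nat_into[OF \<open>T \<noteq> {}\<close>] by (auto simp: t_def)
  have cov': "\<exists>i. 0 < f (t i) z" if "z \<in> O'" for z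
    using cov[OF that] range_from_nat_into[OF \<open>T \<noteq> {}\<close> T(2)] by (metis t_def image_iff)
  \<comment> \<open>Partial sums avoid any question of convergence. The factor \<open>real n\<close>
    eventually lifts a positive value above 1, where \<open>min\<close> stops it, so the limit is
    exactly the indicator.\<close>
  define h where "h n z = min 1 (real n * (\<Sum>i<n. f (t i) z))" for n z
  have s0: "0 \<le> (\<Sum>i<n. f (t i) z)" for n z
    by (intro sum_nonneg f t)
  show thesis
  proof
    show "continuous_on UNIV (h n)" for n
      unfolding h_def by (intro continuous_intros f t)
    show "0 \<le> h n z" "h n z \<le> 1" for n z
      using s0 by (auto simp: h_def)
    show "h n z = 0" if "z \<notin> O'" for n z
      using f(4)[OF t that] by (simp add: h_def)
    show "(\<lambda>n. h n z) \<longlonglongrightarrow> indicator O' z" for z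
    proof (cases "z \<in> O'")
      case True
      obtain i where i: "0 < f (t i) z" using cov'[OF True] by auto
      obtain m where m: "1 / f (t i) z \<le> real m" using real_arch_simple by blast
      have "h n z = 1" if n: "n \<ge> max m (Suc i)" for n
      proof -
        have "1 \<le> real m * f (t i) z" using m i by (simp add: field_simps)
        also have "\<dots> \<le> real n * f (t i) z" using n i by (intro mult_right_mono) auto
        also have "\<dots> \<le> real n * (\<Sum>i<n. f (t i) z)"
          using n f(2)[OF t] by (intro mult_left_mono member_le_sum) auto
        finally show ?thesis by (simp add: h_def)
      qed
      then have "eventually (\<lambda>n. h n z = 1) sequentially"
        unfolding eventually_sequentially by blast
      then show ?thesis using True by (simp add: tendsto_eventually)
    qed (use f(4)[OF t] in \<open>simp add: h_def\<close>)
  qed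
qed

text \<open>The Baire functions over \<open>V\<close>. One sequential limit of continuous functions
  does not reach every Borel function, so limits are iterated; rule induction then replaces a
  transfinite induction over the Baire classes.\<close>

inductive_set pointwise_closure :: "('a \<Rightarrow> real) set \<Rightarrow> ('a \<Rightarrow> real) set" for V where
  base: "f \<in> V \<Longrightarrow> f \<in> pointwise_closure V"
| lim: "(\<And>n. f n \<in> pointwise_closure V) \<Longrightarrow> (\<And>z. (\<lambda>n. f n z) \<longlonglongrightarrow> g z) \<Longrightarrow> g \<in> pointwise_closure V"

lemma pointwise_closure_scale:
  assumes V: "\<And>f. f \<in> V \<Longrightarrow> (\<lambda>z. c * f z) \<in> V" and f: "f \<in> pointwise_closure V"
  shows "(\<lambda>z. c * f z) \<in> pointwise_closure V"
  using f
proof induction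
  case (lim f g)
  show ?case
    by (rule pointwise_closure.lim[OF lim.IH]) (rule tendsto_mult_left[OF lim.hyps(2)])
qed (intro pointwise_closure.base V)

text \<open>The summands may arise at different stages of the iteration, so one argument is varied
  at a time: \<open>g\<close> with \<open>f\<close> in \<open>V\<close> first, then \<open>f\<close>
  with \<open>g\<close> arbitrary.\<close>

lemma pointwise_closure_add:
  assumes V: "\<And>f g. f \<in> V \<Longrightarrow> g \<in> V \<Longrightarrow> (\<lambda>z. f z + g z) \<in> V"
    and f: "f \<in> pointwise_closure V" and g: "g \<in> pointwise_closure V"
  shows "(\<lambda>z. f z + g z) \<in> pointwise_closure V"
  using f
proof induction
  case (base f)
  show ?case
    using g
  proof induction
    case (base g)
    with \<open>f \<in> V\<close> show ?case by (intro pointwise_closure.base V)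
  next
    case (lim g' g)
    show ?case
      by (rule pointwise_closure.lim[OF lim.IH]) (rule tendsto_add[OF tendsto_const lim.hyps(2)])
  qed
next
  case (lim f' f)
  show ?case
    by (rule pointwise_closure.lim[OF lim.IH]) (rule tendsto_add[OF lim.hyps(2) tendsto_const])
qed

text \<open>A functional monotone class theorem relative to \<open>W\<close>. In one application
  \<open>F\<close> consists of functions that vanish off a cylinder and in general contains no
  nonzero constant, so only indicators of subsets of \<open>W\<close> are required and complements
  are formed inside \<open>W\<close>.\<close>

lemma measurable_in_pointwise_closed:
  fixes F :: "('a \<Rightarrow> real) set"
  assumes M: "sets M = sigma_sets UNIV E" and E: "Int_stable E"
    and ind: "\<And>B. B \<in> E \<Longrightarrow> indicator (B \<inter> W) \<in> F" and W: "indicator W \<in> F"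
    and add: "\<And>f g. f \<in> F \<Longrightarrow> g \<in> F \<Longrightarrow> (\<lambda>z. f z + g z) \<in> F"
    and scale: "\<And>c f. f \<in> F \<Longrightarrow> (\<lambda>z. c * f z) \<in> F"
    and lim: "\<And>f g. (\<And>n. f n \<in> F) \<Longrightarrow> (\<And>z. (\<lambda>n. f n z) \<longlonglongrightarrow> g z) \<Longrightarrow> g \<in> F"
    and f: "f \<in> borel_measurable M" and off: "\<And>z. z \<notin> W \<Longrightarrow> f z = 0"
  shows "f \<in> F"
proof -
  have sp: "space M = UNIV"
    using M by (metis sets.sets_into_space sigma_sets_top subset_UNIV subset_antisym)
  have zero: "(\<lambda>_. 0) \<in> F"
    using scale[OF W, of 0] by simp
  have sets: "indicator (B \<inter> W) \<in> F" if "B \<in> sets M" for B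
  proof -
    have "B \<in> sigma_sets UNIV E" using that M by simp
    with E subset_UNIV[of E, folded Pow_UNIV] show ?thesis
    proof (induction B rule: sigma_sets_induct_disjoint)
      case (compl A)
      have "indicator ((UNIV - A) \<inter> W) = (\<lambda>z. indicator W z + (-1) * indicator (A \<inter> W) z :: real)"
        by (auto simp: indicator_def fun_eq_iff)
      then show ?case
        using add[OF W scale[OF compl.IH, of "-1"]] by simp
    next
      case (union A)
      have fin: "(\<lambda>z. \<Sum>i<n. indicator (A i \<inter> W) z) \<in> F" for n
        by (induction n) (auto intro: zero add union.IH)
      have "indicator (\<Union> (range A) \<inter> W) z = (indicator (\<Union>i. A i \<inter> W) z :: real)" for z
        by (auto simp: indicator_def)
      moreover have "(\<lambda>i. indicator (A i \<inter> W) z :: real) sums indicator (\<Union>i. A i \<inter> W) z" for z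
        using union by (intro indicator_sums) (auto simp: disjoint_family_on_def)
      ultimately show ?case
        by (intro lim[OF fin]) (simp add: sums_def)
    qed (use ind zero in \<open>auto simp: indicator_def[abs_def]\<close>)
  qed
  have pos: "(\<lambda>z. indicator W z * g z) \<in> F" if "g \<in> borel_measurable M" "\<And>z. 0 \<le> g z" for g
    using that
  proof (induction g rule: borel_measurable_induct_real)
    case (set A)
    moreover have "(\<lambda>z. indicator W z * indicator A z :: real) = indicator (A \<inter> W)"
      by (auto simp: fun_eq_iff indicator_def)
    ultimately show ?case using sets by simp
  next
    case (mult u c)
    then show ?case using scale[of "\<lambda>z. indicator W z * u z" c] by (simp add: ac_simps)
  next
    case (add u v)
    then show ?case using assms(5)[of "\<lambda>z. indicator W z * v z" "\<lambda>z. indicator W z * u z"]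
      by (simp add: algebra_simps)
  next
    case (seq U)
    show ?case
      by (rule lim[of "\<lambda>i z. indicator W z * U i z"]) (auto simp: sp seq intro!: tendsto_mult_left)
  qed
  have "f = (\<lambda>z. indicator W z * max 0 (f z) + (-1) * (indicator W z * max 0 (- f z)))"
    using off by (auto simp: fun_eq_iff indicator_def)
  also have "\<dots> \<in> F"
    using f by (intro add scale pos) auto
  finally show ?thesis .
qed

section \<open>The configuration space\<close>

lemma space_configuration_algebra: "space configuration_algebra = marked_configurations"
  by (simp add: configuration_algebra_def space_measure_of_conv)

lemma sets_configuration_algebra:
  "sets configuration_algebra =
    sigma_sets marked_configurations {(\<lambda>\<omega>. card (\<omega> \<inter> B)) -` N \<inter> marked_configurations | B N. B \<in> borel_c}"
  unfolding configuration_algebra_def by (rule sets_measure_of) auto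

lemma finite_marked_configuration_Int:
  assumes "\<omega> \<in> marked_configurations" "compact (closure U)"
  shows "finite (\<omega> \<inter> U \<times> UNIV)"
proof (rule finite_imageD)
  have "fst ` (\<omega> \<inter> U \<times> UNIV) \<subseteq> fst ` \<omega> \<inter> closure U"
    using closure_subset[of U] by auto
  moreover have "finite (fst ` \<omega> \<inter> closure U)"
    using assms by (auto simp: marked_configurations_def)
  ultimately show "finite (fst ` (\<omega> \<inter> U \<times> UNIV))"
    by (rule finite_subset)
  show "inj_on fst (\<omega> \<inter> U \<times> UNIV)"
    using assms by (auto simp: marked_configurations_def intro: inj_on_subset)
qed

section \<open>Measurability of sums over the points of a configuration\<close>

lemma measurable_configuration_card:
  assumes "B \<in> borel_c"
  shows "(\<lambda>\<omega>. card (\<omega> \<inter> B)) \<in> configuration_algebra \<rightarrow>\<^sub>M count_space UNIV"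
proof (rule measurableI)
  fix N :: "nat set"
  show "(\<lambda>\<omega>. card (\<omega> \<inter> B)) -` N \<inter> space configuration_algebra \<in> sets configuration_algebra"
    unfolding space_configuration_algebra sets_configuration_algebra
    using assms by (intro sigma_sets.Basic) blast
qed simp

lemma sets_borel_prod_rectangles:
  "sets (borel :: ('a::second_countable_topology \<times> 'b::second_countable_topology) measure) =
    sigma_sets UNIV {A \<times> C | A C. A \<in> sets borel \<and> C \<in> sets borel}"
  unfolding borel_prod[symmetric] sets_pair_measure by simp

text \<open>Over a relatively compact cylinder the sum is finite, so it commutes with pointwise
  limits of \<open>f\<close>. For a rectangle it is a counting variable: the projection of
  \<open>(A \<inter> U) \<times> C\<close> is \<open>A \<inter> U\<close>, or empty if
  \<open>C\<close> is, and hence visibly Borel. The monotone class argument does the rest.\<close>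

lemma borel_measurable_configuration_sum:
  fixes f :: "'x::{t2_space, second_countable_topology} \<times> 'm::{t2_space, second_countable_topology} \<Rightarrow> real"
  assumes U: "open U" "compact (closure U)" and f: "f \<in> borel_measurable borel"
  shows "(\<lambda>\<omega>. \<Sum>z\<in>\<omega> \<inter> U \<times> UNIV. f z) \<in> borel_measurable configuration_algebra"
proof -
  define F :: "('x \<times> 'm \<Rightarrow> real) set"
    where "F = {f. (\<lambda>\<omega>. \<Sum>z\<in>\<omega> \<inter> U \<times> UNIV. f z) \<in> borel_measurable configuration_algebra}"
  let ?R = "{A \<times> C | (A :: 'x set) (C :: 'm set). A \<in> sets borel \<and> C \<in> sets borel}"
  have ind: "indicator (A \<times> C \<inter> U \<times> UNIV) \<in> F" if "A \<in> sets borel" "C \<in> sets borel" for A :: "'x set" and C :: "'m set"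
  proof -
    let ?B = "(A \<inter> U) \<times> C"
    have "compact (closure (A \<inter> U))"
      using U(2) by (rule compact_closure_mono) auto
    have "fst ` ?B \<in> {A \<inter> U, {}}" by auto
    moreover have "?B \<in> sets borel"
      using that U by (simp add: sets_borel_prod_rectangles) (blast intro: sigma_sets.Basic sets.Int borel_open)
    ultimately have "?B \<in> borel_c"
      using that U \<open>compact (closure (A \<inter> U))\<close>
      by (auto simp: borel_c_def)
    from measurable_configuration_card[OF this]
    have "(\<lambda>\<omega>. real (card (\<omega> \<inter> ?B))) \<in> borel_measurable configuration_algebra"
      by (rule measurable_compose) simp
    also have "?this \<longleftrightarrow> (\<lambda>\<omega>. \<Sum>z\<in>\<omega> \<inter> U \<times> UNIV. indicator (A \<times> C \<inter> U \<times> UNIV) z :: real)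
        \<in> borel_measurable configuration_algebra"
    proof (rule measurable_cong)
      fix \<omega> :: "('x \<times> 'm) set" assume "\<omega> \<in> space configuration_algebra"
      then have "finite (\<omega> \<inter> U \<times> UNIV)"
        using U by (simp add: space_configuration_algebra finite_marked_configuration_Int)
      then have "(\<Sum>z\<in>\<omega> \<inter> U \<times> UNIV. indicator (A \<times> C \<inter> U \<times> UNIV) z :: real)
          = real (card (\<omega> \<inter> U \<times> UNIV \<inter> (A \<times> C \<inter> U \<times> UNIV)))"
        by (simp add: indicator_def of_bool_def sum.If_cases del: mem_Times_iff Int_iff)
      also have "\<omega> \<inter> U \<times> UNIV \<inter> (A \<times> C \<inter> U \<times> UNIV) = \<omega> \<inter> ?B" by auto
      finally show "real (card (\<omega> \<inter> ?B)) = (\<Sum>z\<in>\<omega> \<inter> U \<times> UNIV. indicator (A \<times> C \<inter> U \<times> UNIV) z)" ..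
    qed
    finally show ?thesis by (simp add: F_def)
  qed
  have "(\<lambda>z. indicator (U \<times> UNIV) z * f z) \<in> F"
  proof (rule measurable_in_pointwise_closed[OF sets_borel_prod_rectangles, where W = "U \<times> UNIV"])
    show "Int_stable ?R"
      unfolding Int_stable_def by (auto simp: Times_Int_Times) blast
    show "indicator (B \<inter> U \<times> UNIV) \<in> F" if "B \<in> ?R" for B
      using that ind by auto
    show "indicator (U \<times> UNIV) \<in> F"
      using ind[of UNIV UNIV] by simp
    show "(\<lambda>z. f z + g z) \<in> F" if "f \<in> F" "g \<in> F" for f g
      using that by (auto simp: F_def sum.distrib)
    show "(\<lambda>z. c * f z) \<in> F" if "f \<in> F" for c f
      using that by (auto simp: F_def sum_distrib_left[symmetric])
    show "g \<in> F" if "\<And>n. f n \<in> F" "\<And>z. (\<lambda>n. f n z) \<longlonglongrightarrow> g z" for f g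
      unfolding F_def mem_Collect_eq
      by (rule borel_measurable_LIMSEQ_real[where u = "\<lambda>n \<omega>. \<Sum>z\<in>\<omega> \<inter> U \<times> UNIV. f n z"])
        (use that in \<open>auto simp: F_def intro!: tendsto_sum\<close>)
    show "(\<lambda>z. indicator (U \<times> UNIV) z * f z) \<in> borel_measurable borel"
      using f U by (intro borel_measurable_times borel_measurable_indicator borel_open open_Times) auto
  qed auto
  moreover have "(\<Sum>z\<in>\<omega> \<inter> U \<times> UNIV. indicator (U \<times> UNIV) z * f z) = (\<Sum>z\<in>\<omega> \<inter> U \<times> UNIV. f z)" for \<omega>
    by (intro sum.cong) (auto simp: indicator_def)
  ultimately show ?thesis
    by (simp add: F_def)
qed

text \<open>Unlike in \<open>borel_c\<close>, the projection of \<open>B\<close> is not asked to be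
  Borel: the cells into which a set is cut below, and preimages under the action, need not have
  Borel projections.\<close>

definition void_events :: "('x::topological_space \<times> 'm::topological_space) set set set" where
  "void_events = {{\<omega> \<in> marked_configurations. \<omega> \<inter> B = {}} | B. B \<in> sets borel \<and> compact (closure (fst ` B))}"

lemma void_eventsI:
  fixes B :: "('x::t2_space \<times> 'm::topological_space) set"
  assumes "B \<in> sets borel" "B \<subseteq> U \<times> UNIV" "compact (closure U)"
  shows "{\<omega> \<in> marked_configurations. \<omega> \<inter> B = {}} \<in> void_events"
proof -
  have "compact (closure (fst ` B))"
    using assms(3) by (rule compact_closure_mono) (use assms(2) in auto)
  then show ?thesis
    using assms(1) by (auto simp: void_events_def)
qed

lemma Int_stable_void_events: "Int_stable void_events"
proof (rule Int_stableI)
  fix a b :: "('x::topological_space \<times> 'm::topological_space) set set"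
  assume "a \<in> void_events" "b \<in> void_events"
  then obtain A B where A: "a = {\<omega> \<in> marked_configurations. \<omega> \<inter> A = {}}" "A \<in> sets borel" "compact (closure (fst ` A))"
    and B: "b = {\<omega> \<in> marked_configurations. \<omega> \<inter> B = {}}" "B \<in> sets borel" "compact (closure (fst ` B))"
    by (auto simp: void_events_def)
  have "a \<inter> b = {\<omega> \<in> marked_configurations. \<omega> \<inter> (A \<union> B) = {}}"
    using A B by auto
  moreover have "compact (closure (fst ` (A \<union> B)))"
    using A B by (simp add: image_Un compact_Un)
  ultimately show "a \<inter> b \<in> void_events"
    using A B unfolding void_events_def by blast
qed

text \<open>As \<open>B\<close> may lie outside \<open>borel_c\<close>, the number of its points is
  not one of the generating variables. It is still a measurable sum over a cylinder, and a finite
  sum of nonnegative terms is 0 only if every term is.\<close>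

lemma void_event_measurable:
  fixes B :: "('x::{t2_space, second_countable_topology} \<times> 'm::{t2_space, second_countable_topology}) set"
  assumes U: "open U" "compact (closure U)" and B: "B \<in> sets borel" "B \<subseteq> U \<times> UNIV"
  shows "{\<omega> \<in> marked_configurations. \<omega> \<inter> B = {}} \<in> sets configuration_algebra"
proof -
  have "{\<omega> \<in> space configuration_algebra. (\<Sum>z\<in>\<omega> \<inter> U \<times> UNIV. indicator B z :: real) = 0} \<in> sets configuration_algebra"
    using borel_measurable_configuration_sum[OF U borel_measurable_indicator[OF B(1)]] by measurable
  also have "{\<omega> \<in> space configuration_algebra. (\<Sum>z\<in>\<omega> \<inter> U \<times> UNIV. indicator B z :: real) = 0}
      = {\<omega> \<in> marked_configurations. \<omega> \<inter> B = {}}"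
  proof (intro Collect_cong conj_cong refl)
    fix \<omega> :: "('x \<times> 'm) set" assume "\<omega> \<in> marked_configurations"
    from finite_marked_configuration_Int[OF this U(2)]
    show "((\<Sum>z\<in>\<omega> \<inter> U \<times> UNIV. indicator B z :: real) = 0) = (\<omega> \<inter> B = {})"
      using B(2) by (subst sum_nonneg_eq_0_iff) (auto simp: indicator_def)
  qed (simp add: space_configuration_algebra)
  finally show ?thesis .
qed

text \<open>Configurations are simple, so the number of points in \<open>B\<close> is the limit of the number of
  non-void cells of ever finer partitions of \<open>B\<close>.\<close>

lemma sets_configuration_algebra_void_events:
  assumes lc: "locally_compact_space (euclidean :: 'x::{t2_space, second_countable_topology} topology)"
  shows "sets (configuration_algebra :: ('x \<times> 'm::{t2_space, second_countable_topology}) set measure)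
    = sigma_sets marked_configurations void_events"
proof
  show "sigma_sets marked_configurations void_events \<subseteq> sets (configuration_algebra :: ('x \<times> 'm) set measure)"
  proof -
    have "(void_events :: ('x \<times> 'm) set set set) \<subseteq> sets configuration_algebra"
    proof
      fix a :: "('x \<times> 'm) set set" assume "a \<in> void_events"
      then obtain B where B: "a = {\<omega> \<in> marked_configurations. \<omega> \<inter> B = {}}" "B \<in> sets borel" "compact (closure (fst ` B))"
        by (auto simp: void_events_def)
      obtain U where U: "open U" "compact (closure U)" "closure (fst ` B) \<subseteq> U"
        using compact_relatively_compact_nbhd[OF lc B(3)] by metis
      then have "B \<subseteq> U \<times> UNIV"
        using closure_subset[of "fst ` B"] by force
      with B U show "a \<in> sets configuration_algebra"
        by (simp add: void_event_measurable)
    qed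
    then show ?thesis
      using sets.sigma_sets_subset[of void_events configuration_algebra] by (simp add: space_configuration_algebra)
  qed
next
  define S where "S = sigma (marked_configurations :: ('x \<times> 'm) set set) void_events"
  have "(void_events :: ('x \<times> 'm) set set set) \<subseteq> Pow marked_configurations"
    by (auto simp: void_events_def)
  then have S: "sets S = sigma_sets marked_configurations void_events" "space S = marked_configurations"
    by (simp_all add: S_def space_measure_of_conv)
  obtain \<B> :: "('x \<times> 'm) set set" where \<B>: "countable \<B>" "topological_basis \<B>"
    using ex_countable_basis by auto
  have "\<B> \<noteq> {}"
    using topological_basisE[OF \<B>(2) open_UNIV UNIV_I] by blast
  define b where "b = from_nat_into \<B>"
  have rb: "range b = \<B>"
    unfolding b_def using \<B>(1) \<open>\<B> \<noteq> {}\<close> by (rule range_from_nat_into[rotated])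
  have b_open: "open (b i)" for i
    using rb \<B>(2) topological_basis_open by blast
  have sep: "\<exists>i. z \<in> b i \<and> z' \<notin> b i" if "z \<noteq> z'" for z z'
  proof -
    obtain O1 where "open O1" "z \<in> O1" "z' \<notin> O1"
      using t1_space[OF \<open>z \<noteq> z'\<close>] by auto
    then show ?thesis
      using topological_basisE[OF \<B>(2), of O1 z] rb by (metis rangeE subsetD)
  qed
  \<comment> \<open>The code of \<open>z\<close> records which of the first \<open>n\<close> basic
    open sets contain \<open>z\<close>. Its fibres are the cells of the n-th partition, labelled by
    the finitely many subsets of \<open>{..<n}\<close>.\<close>
  define cd where "cd n z = {i. i < n \<and> z \<in> b i}" for n z
  have cd_meas: "cd n -` {c} \<in> sets borel" for n c
  proof -
    have [measurable]: "b i \<in> sets borel" for i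
      using b_open by (rule borel_open)
    have "cd n -` {c} = {z \<in> space borel. c \<subseteq> {..<n} \<and> (\<forall>i\<in>{..<n}. z \<in> b i \<longleftrightarrow> i \<in> c)}"
      unfolding cd_def set_eq_iff by auto
    also have "\<dots> \<in> sets borel"
      by measurable
    finally show ?thesis .
  qed
  \<comment> \<open>\<open>m\<close> exceeds a separating index of every pair of distinct points of
    \<open>A\<close>, so from level \<open>m\<close> on the codes are injective on
    \<open>A\<close>.\<close>
  have card_lim: "(\<lambda>n. real (card (cd n ` A))) \<longlonglongrightarrow> real (card A)" if "finite A" for A
  proof -
    obtain i where i: "\<And>z z'. z \<noteq> z' \<Longrightarrow> z \<in> b (i z z') \<and> z' \<notin> b (i z z')"
      using sep by metis
    have "finite (\<Union>z\<in>A. i z ` A)" using that by simp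
    then obtain m where "\<forall>k\<in>(\<Union>z\<in>A. i z ` A). k < m"
      unfolding finite_nat_set_iff_bounded by blast
    then have m: "i z z' < m" if "z \<in> A" "z' \<in> A" for z z'
      using that by blast
    have "card (cd n ` A) = card A" if "n \<ge> m" for n
    proof (rule card_image, rule inj_onI, rule ccontr)
      fix z z' assume z: "z \<in> A" "z' \<in> A" "cd n z = cd n z'" "z \<noteq> z'"
      then have "i z z' < n" "z \<in> b (i z z')" "z' \<notin> b (i z z')"
        using i[of z z'] m[of z z'] that by simp_all
      then have "i z z' \<in> cd n z" "i z z' \<notin> cd n z'"
        by (simp_all add: cd_def)
      then show False using z by simp
    qed
    then show ?thesis
      by (intro tendsto_eventually) (auto simp: eventually_sequentially)
  qed
  have meas: "(\<lambda>\<omega>. card (\<omega> \<inter> B)) -` N \<inter> marked_configurations \<in> sets S" if B: "B \<in> borel_c" for B N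
  proof -
    have void: "{\<omega> \<in> space S. \<omega> \<inter> (B \<inter> cd n -` {c}) = {}} \<in> sets S" for n c
      unfolding S using B cd_meas
      by (intro sigma_sets.Basic void_eventsI[where U = "fst ` B"]) (force simp: borel_c_def)+
    have "(\<lambda>\<omega>. real (card (\<omega> \<inter> B))) \<in> borel_measurable S"
    proof (rule borel_measurable_LIMSEQ_real)
      fix n
      show "(\<lambda>\<omega>. \<Sum>c\<in>Pow {..<n}. if \<omega> \<inter> (B \<inter> cd n -` {c}) = {} then 0 else 1 :: real) \<in> borel_measurable S"
        by (intro borel_measurable_sum measurable_If void) auto
    next
      fix \<omega> assume "\<omega> \<in> space S"
      then have "finite (\<omega> \<inter> fst ` B \<times> UNIV)"
        using B by (intro finite_marked_configuration_Int) (auto simp: S borel_c_def)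
      then have fin: "finite (\<omega> \<inter> B)"
        by (rule finite_subset[rotated]) force
      \<comment> \<open>A cell meets \<open>\<omega> \<inter> B\<close> exactly if its label is the
        code of one of these points, so non-void cells are counted by codes.\<close>
      have "(\<Sum>c\<in>Pow {..<n}. if \<omega> \<inter> (B \<inter> cd n -` {c}) = {} then 0 else 1 :: real) = real (card (cd n ` (\<omega> \<inter> B)))" for n
      proof -
        have "(\<Sum>c\<in>Pow {..<n}. if \<omega> \<inter> (B \<inter> cd n -` {c}) = {} then 0 else 1 :: real)
            = (\<Sum>c\<in>Pow {..<n}. if c \<in> cd n ` (\<omega> \<inter> B) then 1 else 0)"
          by (intro sum.cong) auto
        also have "\<dots> = real (card (Pow {..<n} \<inter> cd n ` (\<omega> \<inter> B)))"
          by (simp add: sum.If_cases)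
        also have "Pow {..<n} \<inter> cd n ` (\<omega> \<inter> B) = cd n ` (\<omega> \<inter> B)"
          by (auto simp: cd_def)
        finally show ?thesis .
      qed
      then show "(\<lambda>n. \<Sum>c\<in>Pow {..<n}. if \<omega> \<inter> (B \<inter> cd n -` {c}) = {} then 0 else 1) \<longlonglongrightarrow> real (card (\<omega> \<inter> B))"
        using card_lim[OF fin] by simp
    qed
    then have "(\<lambda>\<omega>. real (card (\<omega> \<inter> B))) -` (real ` N) \<inter> space S \<in> sets S"
      by (rule measurable_sets) (auto intro: sets.countable[OF _ countable_image])
    also have "(\<lambda>\<omega>. real (card (\<omega> \<inter> B))) -` (real ` N) = (\<lambda>\<omega>. card (\<omega> \<inter> B)) -` N"
      by auto
    finally show ?thesis by (simp add: S)
  qed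
  show "sets (configuration_algebra :: ('x \<times> 'm) set measure) \<subseteq> sigma_sets marked_configurations void_events"
  proof -
    have "sigma_sets (space S) {(\<lambda>\<omega>. card (\<omega> \<inter> B)) -` N \<inter> marked_configurations | B N. B \<in> borel_c} \<subseteq> sets S"
      using meas by (intro sets.sigma_sets_subset) auto
    then show ?thesis
      unfolding sets_configuration_algebra S by simp
  qed
qed

lemma configuration_measure_eqI:
  assumes lc: "locally_compact_space (euclidean :: 'x::{t2_space, second_countable_topology} topology)"
    and P: "finite_measure P"
    and sets: "sets P = sets (configuration_algebra :: ('x \<times> 'm::{t2_space, second_countable_topology}) set measure)"
      "sets Q = sets configuration_algebra"
    and eq: "\<And>B U. open U \<Longrightarrow> compact (closure U) \<Longrightarrow> B \<in> sets borel \<Longrightarrow> B \<subseteq> U \<times> UNIV \<Longrightarrow>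
      emeasure P {\<omega> \<in> marked_configurations. \<omega> \<inter> B = {}} = emeasure Q {\<omega> \<in> marked_configurations. \<omega> \<inter> B = {}}"
  shows "P = Q"
proof (rule measure_eqI_generator_eq[OF Int_stable_void_events])
  show "emeasure P a = emeasure Q a" if a: "a \<in> void_events" for a
  proof -
    obtain B where B: "a = {\<omega> \<in> marked_configurations. \<omega> \<inter> B = {}}" "B \<in> sets borel" "compact (closure (fst ` B))"
      using a unfolding void_events_def by blast
    obtain U where U: "open U" "compact (closure U)" "closure (fst ` B) \<subseteq> U"
      using compact_relatively_compact_nbhd[OF lc B(3)] by metis
    then have "B \<subseteq> U \<times> UNIV"
      using closure_subset[of "fst ` B"] by force
    with B U eq show ?thesis by blast
  qed
  \<comment> \<open>The void event of the empty set is the whole space. It serves as a constant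
    exhausting sequence and makes the total masses agree as a special case of
    \<open>eq\<close>.\<close>
  have "marked_configurations \<in> (void_events :: ('x \<times> 'm) set set set)"
    using void_eventsI[of "{}" "{}"] by simp
  then show "range (\<lambda>i::nat. marked_configurations) \<subseteq> (void_events :: ('x \<times> 'm) set set set)"
    by auto
qed (use sets_configuration_algebra_void_events[OF lc] sets finite_measure.emeasure_finite[OF P] in
    \<open>auto simp: void_events_def\<close>)

section \<open>Multiplicative functionals of the Poisson measure\<close>

text \<open>The manifolds enter only through local compactness. For a non-compact mark space,
  finiteness over \<open>K \<times> UNIV\<close> is more than local finiteness on the product; all
  estimates take place on such cylinders.\<close>

locale poisson_configurations =
  fixes \<sigma> :: "('x::{t2_space, second_countable_topology} \<times> 'm::{t2_space, second_countable_topology}) measure"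
    and \<pi> :: "('x \<times> 'm) set measure"
  assumes lcX: "locally_compact_space (euclidean :: 'x topology)"
    and lcM: "locally_compact_space (euclidean :: 'm topology)"
    and sets_intensity: "sets \<sigma> = sets borel"
    and finite_intensity: "\<And>K. compact K \<Longrightarrow> emeasure \<sigma> (K \<times> UNIV) < \<infinity>"
    and poisson: "marked_poisson_measure \<sigma> \<pi>"
begin

sublocale prob_space \<pi>
  using poisson by (simp add: marked_poisson_measure_def)

lemma sets_poisson: "sets \<pi> = sets configuration_algebra"
  using poisson by (simp add: marked_poisson_measure_def)

lemma space_poisson: "space \<pi> = marked_configurations"
  using sets_eq_imp_space_eq[OF sets_poisson] by (simp add: space_configuration_algebra)

lemma space_intensity: "space \<sigma> = UNIV"
  using sets_eq_imp_space_eq[OF sets_intensity] by simp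

lemma lc_product: "locally_compact_space (euclidean :: ('x \<times> 'm) topology)"
  unfolding locally_compact_space_def
proof
  fix z :: "'x \<times> 'm"
  obtain U K where U: "open U" "compact K" "fst z \<in> U" "U \<subseteq> K"
    using lcX unfolding locally_compact_space_def by (metis UNIV_I compactin_euclidean_iff open_openin topspace_euclidean)
  obtain V L where V: "open V" "compact L" "snd z \<in> V" "V \<subseteq> L"
    using lcM unfolding locally_compact_space_def by (metis UNIV_I compactin_euclidean_iff open_openin topspace_euclidean)
  show "\<exists>U K. openin euclidean U \<and> compactin euclidean K \<and> z \<in> U \<and> U \<subseteq> K"
    using U V by (intro exI[of _ "U \<times> V"] exI[of _ "K \<times> L"])
      (auto simp: mem_Times_iff intro: open_Times compact_Times)
qed

lemma cylinder_sets: "open U \<Longrightarrow> U \<times> UNIV \<in> sets \<sigma>"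
  by (simp add: sets_intensity open_Times)

lemma emeasure_cylinder_finite:
  assumes "compact (closure U)"
  shows "emeasure \<sigma> (U \<times> UNIV) < \<infinity>"
proof -
  have "emeasure \<sigma> (U \<times> UNIV) \<le> emeasure \<sigma> (closure U \<times> UNIV)"
    using closure_subset[of U]
    by (intro emeasure_mono) (auto simp: sets_intensity intro!: borel_closed closed_Times)
  also have "\<dots> < \<infinity>"
    by (rule finite_intensity[OF assms])
  finally show ?thesis .
qed

lemma test_functionI:
  assumes U: "compact (closure U)"
    and f: "continuous_on UNIV f" "bounded (range f)" "\<And>z. z \<notin> U \<times> UNIV \<Longrightarrow> f z = 0"
  shows "test_function (f :: 'x \<times> 'm \<Rightarrow> real)"
proof -
  let ?S = "closure {z. f z \<noteq> 0}"
  have "{z. f z \<noteq> 0} \<subseteq> closure U \<times> UNIV"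
    using f(3) closure_subset[of U] by fastforce
  then have "?S \<subseteq> closure U \<times> UNIV"
    by (intro closure_minimal closed_Times) auto
  then have "fst ` ?S \<subseteq> closure U" by auto
  then have "compact (closure (fst ` ?S))"
    by (rule compact_closure_mono[rotated]) (simp add: U)
  moreover have "fst ` ?S \<in> sets borel"
    by (rule borel_fst_image_closed[OF lcX lcM]) simp
  ultimately show ?thesis
    using f by (simp add: test_function_def borel_c_def)
qed

section \<open>The Laplace functional and exponential moments\<close>

lemma laplace_continuous:
  fixes f :: "'x \<times> 'm \<Rightarrow> real"
  assumes U: "open U" "compact (closure U)"
    and f: "continuous_on UNIV f" "bounded (range f)" "\<And>z. z \<notin> U \<times> UNIV \<Longrightarrow> f z = 0"
  shows "integrable \<pi> (\<lambda>\<omega>. exp (\<Sum>z\<in>\<omega> \<inter> U \<times> UNIV. f z))"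
    and "(\<integral>\<omega>. exp (\<Sum>z\<in>\<omega> \<inter> U \<times> UNIV. f z) \<partial>\<pi>) = exp (\<integral>z. (exp (f z) - 1) \<partial>\<sigma>)"
proof -
  have "(\<integral>\<omega>. exp (\<Sum>\<^sub>\<infinity>z\<in>\<omega>. f z) \<partial>\<pi>) = exp (\<integral>z. (exp (f z) - 1) \<partial>\<sigma>)"
    using poisson test_functionI[OF U(2) f] by (simp add: marked_poisson_measure_def)
  also have "(\<integral>\<omega>. exp (\<Sum>\<^sub>\<infinity>z\<in>\<omega>. f z) \<partial>\<pi>) = (\<integral>\<omega>. exp (\<Sum>z\<in>\<omega> \<inter> U \<times> UNIV. f z) \<partial>\<pi>)"
  proof (intro Bochner_Integration.integral_cong refl arg_cong[of _ _ exp])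
    fix \<omega> assume "\<omega> \<in> space \<pi>"
    then have "finite (\<omega> \<inter> U \<times> UNIV)"
      using U by (simp add: space_poisson finite_marked_configuration_Int)
    then have "(\<Sum>z\<in>\<omega> \<inter> U \<times> UNIV. f z) = (\<Sum>\<^sub>\<infinity>z\<in>\<omega> \<inter> U \<times> UNIV. f z)"
      by simp
    also have "\<dots> = (\<Sum>\<^sub>\<infinity>z\<in>\<omega>. f z)"
      using f(3) by (intro infsum_cong_neutral) auto
    finally show "(\<Sum>\<^sub>\<infinity>z\<in>\<omega>. f z) = (\<Sum>z\<in>\<omega> \<inter> U \<times> UNIV. f z)" ..
  qed
  finally show eq: "(\<integral>\<omega>. exp (\<Sum>z\<in>\<omega> \<inter> U \<times> UNIV. f z) \<partial>\<pi>) = exp (\<integral>z. (exp (f z) - 1) \<partial>\<sigma>)" .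
  show "integrable \<pi> (\<lambda>\<omega>. exp (\<Sum>z\<in>\<omega> \<inter> U \<times> UNIV. f z))"
  proof (rule ccontr)
    \<comment> \<open>A non-integrable function has integral 0 by convention, whereas the right-hand
      side is an exponential and so is positive.\<close>
    assume "\<not> ?thesis"
    then have "(\<integral>\<omega>. exp (\<Sum>z\<in>\<omega> \<inter> U \<times> UNIV. f z) \<partial>\<pi>) = 0"
      by (rule not_integrable_integral_eq)
    with eq show False by simp
  qed
qed

lemma borel_measurable_sum_poisson:
  assumes "open U" "compact (closure U)" and "f \<in> borel_measurable borel"
  shows "(\<lambda>\<omega>. \<Sum>z\<in>\<omega> \<inter> U \<times> UNIV. f z :: real) \<in> borel_measurable \<pi>"
  using borel_measurable_configuration_sum[OF assms]
  by (simp add: measurable_cong_sets[OF sets_poisson refl])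

text \<open>These exponential moments dominate the later limits under \<pi>. The indicator of the
  cylinder is in general not continuous, so the Laplace functional is applied to
  \<open>c * h n\<close> with \<open>h n\<close> continuous and below the indicator, and Fatou's
  lemma passes to the limit.\<close>

lemma integrable_exp_count:
  assumes U: "open U" "compact (closure U)" and c: "0 \<le> (c :: real)"
  shows "integrable \<pi> (\<lambda>\<omega>. exp (\<Sum>z\<in>\<omega> \<inter> U \<times> UNIV. c))"
proof -
  let ?W = "U \<times> (UNIV :: 'm set)"
  have "open ?W" using U by (simp add: open_Times)
  obtain h :: "nat \<Rightarrow> 'x \<times> 'm \<Rightarrow> real" where h: "\<And>n. continuous_on UNIV (h n)"
    "\<And>n z. 0 \<le> h n z" "\<And>n z. h n z \<le> 1" "\<And>n z. z \<notin> ?W \<Longrightarrow> h n z = 0"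
    "\<And>z. (\<lambda>n. h n z) \<longlonglongrightarrow> indicator ?W z"
    using indicator_open_limit[OF lc_product \<open>open ?W\<close>] by metis
  define g where "g n \<omega> = exp (\<Sum>z\<in>\<omega> \<inter> ?W. c * h n z)" for n \<omega>
  \<comment> \<open>The value that the formula predicts in the limit. It bounds the integrals of all
    \<open>g n\<close> because \<open>h n\<close> stays below the indicator.\<close>
  define b where "b = exp (\<integral>z. (exp c - 1) * indicator ?W z \<partial>\<sigma>)"
  have "bounded (range (\<lambda>z. c * h n z))" for n
    using h(2,3) c by (intro boundedI[where B = c]) (auto simp: abs_mult mult_left_le)
  note lap = laplace_continuous[OF U continuous_on_mult_left[OF h(1), of c] this]
  have int_g: "integrable \<pi> (g n)" and g_eq: "(\<integral>\<omega>. g n \<omega> \<partial>\<pi>) = exp (\<integral>z. (exp (c * h n z) - 1) \<partial>\<sigma>)" for n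
    unfolding g_def using lap[of n] h(4) by auto
  have "(\<integral>z. (exp (c * h n z) - 1) \<partial>\<sigma>) \<le> (\<integral>z. (exp c - 1) * indicator ?W z \<partial>\<sigma>)" for n
  proof (rule integral_mono')
    show "integrable \<sigma> (\<lambda>z. (exp c - 1) * indicator ?W z)"
      using emeasure_cylinder_finite[OF U(2)] cylinder_sets[OF U(1)] by simp
    fix z
    show "exp (c * h n z) - 1 \<le> (exp c - 1) * indicator ?W z"
      using h(3)[of n z] h(4)[of z n] c by (cases "z \<in> ?W") (auto simp: mult_left_le)
    show "0 \<le> (exp c - 1) * indicator ?W z"
      using c by simp
  qed
  then have g_le: "(\<integral>\<omega>. g n \<omega> \<partial>\<pi>) \<le> b" for n
    by (simp add: g_eq b_def)
  have nn_g: "(\<integral>\<^sup>+\<omega>. ennreal (g n \<omega>) \<partial>\<pi>) \<le> ennreal b" for n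
  proof -
    have "(\<integral>\<^sup>+\<omega>. ennreal (g n \<omega>) \<partial>\<pi>) = ennreal (\<integral>\<omega>. g n \<omega> \<partial>\<pi>)"
      by (rule nn_integral_eq_integral[OF int_g]) (simp add: g_def)
    then show ?thesis
      using g_le by (simp only:) (rule ennreal_leI)
  qed
  have meas: "(\<lambda>\<omega>. exp (\<Sum>z\<in>\<omega> \<inter> ?W. c)) \<in> borel_measurable \<pi>"
    using borel_measurable_sum_poisson[OF U, of "\<lambda>_. c"] by measurable
  have lim_g: "(\<lambda>n. ennreal (g n \<omega>)) \<longlonglongrightarrow> ennreal (exp (\<Sum>z\<in>\<omega> \<inter> ?W. c))" for \<omega>
  proof -
    have "(\<lambda>n. g n \<omega>) \<longlonglongrightarrow> exp (\<Sum>z\<in>\<omega> \<inter> ?W. c * indicator ?W z)"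
      unfolding g_def by (intro tendsto_exp tendsto_sum tendsto_mult_left h)
    moreover have "(\<Sum>z\<in>\<omega> \<inter> ?W. c * indicator ?W z) = (\<Sum>z\<in>\<omega> \<inter> ?W. c)"
      by (intro sum.cong) (auto simp: indicator_def)
    ultimately show ?thesis by (simp add: tendsto_ennrealI)
  qed
  have "(\<integral>\<^sup>+\<omega>. ennreal (exp (\<Sum>z\<in>\<omega> \<inter> ?W. c)) \<partial>\<pi>) = (\<integral>\<^sup>+\<omega>. liminf (\<lambda>n. ennreal (g n \<omega>)) \<partial>\<pi>)"
    using lim_g by (intro nn_integral_cong lim_imp_Liminf[symmetric]) auto
  also have "\<dots> \<le> liminf (\<lambda>n. \<integral>\<^sup>+\<omega>. ennreal (g n \<omega>) \<partial>\<pi>)"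
    using int_g by (intro nn_integral_liminf) auto
  also have "\<dots> \<le> liminf (\<lambda>n. ennreal b)"
    using nn_g by (intro Liminf_mono) auto
  also have "\<dots> < \<infinity>"
    by (simp add: Liminf_const)
  finally show ?thesis
    using meas by (intro integrableI_nonneg) auto
qed

text \<open>The identity survives pointwise limits only under a common bound, and Baire functions
  may be unbounded. With \<open>min c\<close> built in, every exponential is at most exp (c N) for
  the number N of points in the cylinder. No lower bound is needed because exponentials are
  positive, and \<open>0 \<le> c\<close> preserves the value 0 off the cylinder.\<close>

lemma laplace_bounded_above:
  fixes f :: "'x \<times> 'm \<Rightarrow> real"
  assumes U: "open U" "compact (closure U)" and f: "f \<in> borel_measurable borel"
    and off: "\<And>z. z \<notin> U \<times> UNIV \<Longrightarrow> f z = 0" and c: "0 \<le> c"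
  shows "(\<integral>\<omega>. exp (\<Sum>z\<in>\<omega> \<inter> U \<times> UNIV. min c (f z)) \<partial>\<pi>) = exp (\<integral>z. (exp (min c (f z)) - 1) \<partial>\<sigma>)"
proof -
  let ?W = "U \<times> (UNIV :: 'm set)"
  define V :: "('x \<times> 'm \<Rightarrow> real) set"
    where "V = {f. continuous_on UNIV f \<and> bounded (range f) \<and> (\<forall>z. z \<notin> ?W \<longrightarrow> f z = 0)}"
  have "f \<in> pointwise_closure V"
  proof (rule measurable_in_pointwise_closed[where E = "{S. open S}" and W = ?W])
    show "sets borel = sigma_sets UNIV {S :: ('x \<times> 'm) set. open S}"
      by (simp add: borel_def)
    show "Int_stable {S :: ('x \<times> 'm) set. open S}"
      by (auto simp: Int_stable_def)
    have ind: "indicator S \<in> pointwise_closure V" if S: "open S" "S \<subseteq> ?W" for S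
    proof -
      obtain h :: "nat \<Rightarrow> 'x \<times> 'm \<Rightarrow> real" where h: "\<And>n. continuous_on UNIV (h n)"
        "\<And>n z. 0 \<le> h n z" "\<And>n z. h n z \<le> 1" "\<And>n z. z \<notin> S \<Longrightarrow> h n z = 0"
        "\<And>z. (\<lambda>n. h n z) \<longlonglongrightarrow> indicator S z"
        using indicator_open_limit[OF lc_product S(1)] by metis
      have "bounded (range (h n))" for n
        using h(2,3) by (intro boundedI[where B = 1]) auto
      then have "h n \<in> pointwise_closure V" for n
        using h(1,4) S(2) unfolding V_def by (intro pointwise_closure.base) blast
      then show ?thesis
        using h(5) by (rule pointwise_closure.lim)
    qed
    show "indicator (B \<inter> ?W) \<in> pointwise_closure V" if "B \<in> {S. open S}" for B
      using that U by (intro ind) (auto intro: open_Times)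
    show "indicator ?W \<in> pointwise_closure V"
      using U by (intro ind) (auto intro: open_Times)
    show "(\<lambda>z. f z + g z) \<in> pointwise_closure V" if "f \<in> pointwise_closure V" "g \<in> pointwise_closure V" for f g
      using that
      by (rule pointwise_closure_add[rotated]) (auto simp: V_def intro!: continuous_intros bounded_plus_comp)
    show "(\<lambda>z. c * f z) \<in> pointwise_closure V" if "f \<in> pointwise_closure V" for c f
      using that
      by (rule pointwise_closure_scale[rotated])
        (auto simp: V_def intro!: continuous_intros dest: bounded_scaleR_comp[where r = c])
    show "g \<in> pointwise_closure V" if "\<And>n. f n \<in> pointwise_closure V" "\<And>z. (\<lambda>n. f n z) \<longlonglongrightarrow> g z" for f g
      using that by (rule pointwise_closure.lim)
  qed (use f off in auto)
  \<comment> \<open>Vanishing off the cylinder is carried through the induction since it confines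
    the integrands under \<sigma> to a set of finite measure.\<close>
  then have "f \<in> borel_measurable borel \<and> (\<forall>z. z \<notin> ?W \<longrightarrow> f z = 0) \<and>
    (\<integral>\<omega>. exp (\<Sum>z\<in>\<omega> \<inter> ?W. min c (f z)) \<partial>\<pi>) = exp (\<integral>z. (exp (min c (f z)) - 1) \<partial>\<sigma>)"
  proof induction
    case (base f)
    then have f: "continuous_on UNIV f" "bounded (range f)" "\<And>z. z \<notin> ?W \<Longrightarrow> f z = 0"
      by (auto simp: V_def)
    obtain B where B: "\<And>z. \<bar>f z\<bar> \<le> B"
      using f(2) by (auto simp: bounded_iff)
    have "bounded (range (\<lambda>z. min c (f z)))"
    proof (rule boundedI)
      fix y assume "y \<in> range (\<lambda>z. min c (f z))"
      then obtain z where "y = min c (f z)" by auto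
      then show "norm y \<le> max c B"
        using B[of z] c by auto
    qed
    moreover have "continuous_on UNIV (\<lambda>z. min c (f z))"
      using f(1) by (intro continuous_intros)
    moreover have "\<And>z. z \<notin> ?W \<Longrightarrow> min c (f z) = 0"
      using f(3) c by simp
    ultimately show ?case
      using laplace_continuous(2)[OF U] f by (auto intro: borel_measurable_continuous_onI)
  next
    case (lim f g)
    have f: "\<And>n. f n \<in> borel_measurable borel" "\<And>n z. z \<notin> ?W \<Longrightarrow> f n z = 0"
      "\<And>n. (\<integral>\<omega>. exp (\<Sum>z\<in>\<omega> \<inter> ?W. min c (f n z)) \<partial>\<pi>) = exp (\<integral>z. (exp (min c (f n z)) - 1) \<partial>\<sigma>)"
      using lim.IH by auto
    have g: "g \<in> borel_measurable borel"
      by (rule borel_measurable_LIMSEQ_real[OF lim.hyps(2) f(1)])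
    have g0: "g z = 0" if "z \<notin> ?W" for z
      using lim.hyps(2)[of z] f(2)[OF that] by (simp add: LIMSEQ_const_iff)
    have "(\<lambda>n. \<integral>\<omega>. exp (\<Sum>z\<in>\<omega> \<inter> ?W. min c (f n z)) \<partial>\<pi>) \<longlonglongrightarrow> (\<integral>\<omega>. exp (\<Sum>z\<in>\<omega> \<inter> ?W. min c (g z)) \<partial>\<pi>)"
    proof (rule integral_dominated_convergence[OF _ _ integrable_exp_count[OF U c]])
      show "(\<lambda>\<omega>. exp (\<Sum>z\<in>\<omega> \<inter> ?W. min c (g z))) \<in> borel_measurable \<pi>"
        using g by (intro measurable_compose[OF borel_measurable_sum_poisson[OF U]]) auto
      show "(\<lambda>\<omega>. exp (\<Sum>z\<in>\<omega> \<inter> ?W. min c (f n z))) \<in> borel_measurable \<pi>" for n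
        using f(1) by (intro measurable_compose[OF borel_measurable_sum_poisson[OF U]]) auto
      show "AE \<omega> in \<pi>. (\<lambda>n. exp (\<Sum>z\<in>\<omega> \<inter> ?W. min c (f n z))) \<longlonglongrightarrow> exp (\<Sum>z\<in>\<omega> \<inter> ?W. min c (g z))"
        by (intro AE_I2 tendsto_exp tendsto_sum tendsto_min tendsto_const lim.hyps)
      show "AE \<omega> in \<pi>. norm (exp (\<Sum>z\<in>\<omega> \<inter> ?W. min c (f n z))) \<le> exp (\<Sum>z\<in>\<omega> \<inter> ?W. c)" for n
        unfolding real_norm_def abs_exp_cancel exp_le_cancel_iff by (intro AE_I2 sum_mono) simp
    qed
    moreover have "(\<lambda>n. \<integral>z. (exp (min c (f n z)) - 1) \<partial>\<sigma>) \<longlonglongrightarrow> (\<integral>z. (exp (min c (g z)) - 1) \<partial>\<sigma>)"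
    proof (rule integral_dominated_convergence[where w = "\<lambda>z. exp c * indicator ?W z"])
      show "integrable \<sigma> (\<lambda>z. exp c * indicator ?W z)"
        using emeasure_cylinder_finite[OF U(2)] cylinder_sets[OF U(1)] by simp
      show "(\<lambda>z. exp (min c (g z)) - 1) \<in> borel_measurable \<sigma>" "\<And>n. (\<lambda>z. exp (min c (f n z)) - 1) \<in> borel_measurable \<sigma>"
        using g f(1) by (auto simp: measurable_cong_sets[OF sets_intensity refl])
      show "AE z in \<sigma>. (\<lambda>n. exp (min c (f n z)) - 1) \<longlonglongrightarrow> exp (min c (g z)) - 1"
        by (intro AE_I2 tendsto_diff tendsto_exp tendsto_min tendsto_const lim.hyps)
      show "AE z in \<sigma>. norm (exp (min c (f n z)) - 1) \<le> exp c * indicator ?W z" for n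
      proof (rule AE_I2)
        fix z
        have "exp (min c (f n z)) \<le> exp c" "1 \<le> exp c" "0 < exp (min c (f n z))"
          using c by auto
        then have "\<bar>exp (min c (f n z)) - 1\<bar> \<le> exp c" by linarith
        then show "norm (exp (min c (f n z)) - 1) \<le> exp c * indicator ?W z"
          using f(2)[of z n] c by (cases "z \<in> ?W") auto
      qed
    qed
    then have "(\<lambda>n. exp (\<integral>z. (exp (min c (f n z)) - 1) \<partial>\<sigma>)) \<longlonglongrightarrow> exp (\<integral>z. (exp (min c (g z)) - 1) \<partial>\<sigma>)"
      by (rule tendsto_exp)
    ultimately have "(\<integral>\<omega>. exp (\<Sum>z\<in>\<omega> \<inter> ?W. min c (g z)) \<partial>\<pi>) = exp (\<integral>z. (exp (min c (g z)) - 1) \<partial>\<sigma>)"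
      unfolding f(3) by (rule LIMSEQ_unique)
    with g g0 show ?case by blast
  qed
  then show ?thesis by blast
qed

lemma finite_points:
  "\<omega> \<in> space \<pi> \<Longrightarrow> compact (closure U) \<Longrightarrow> finite (\<omega> \<inter> U \<times> UNIV)"
  by (simp add: space_poisson finite_marked_configuration_Int)

text \<open>With f = ln u the exponential of the sum becomes a product. As \<open>u\<close> may be
  0, it is first raised to a positive lower bound, which then tends to 0.\<close>

lemma integral_prod_bounded:
  fixes u :: "'x \<times> 'm \<Rightarrow> real"
  assumes U: "open U" "compact (closure U)" and u: "u \<in> borel_measurable borel"
    and nn: "\<And>z. 0 \<le> u z" and b: "\<And>z. u z \<le> b"
    and off: "\<And>z. z \<notin> U \<times> UNIV \<Longrightarrow> u z = 1"
  shows "has_bochner_integral \<pi> (\<lambda>\<omega>. \<Prod>z\<in>\<omega> \<inter> U \<times> UNIV. u z) (exp (\<integral>z. (u z - 1) \<partial>\<sigma>))"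
proof -
  let ?W = "U \<times> (UNIV :: 'm set)"
  \<comment> \<open>An upper bound of ln u, so that truncation at \<open>c\<close> in the Laplace
    formula has no effect. Taking \<open>max 1 b\<close> ensures \<open>0 \<le> c\<close>.\<close>
  define c where "c = ln (max 1 b)"
  have c: "0 \<le> c" "exp c = max 1 b" by (simp_all add: c_def)
  \<comment> \<open>The lower bound never exceeds 1, so the value 1 off the cylinder
    survives.\<close>
  define v where "v n z = max (u z) (1 / real (Suc n))" for n z
  have "1 / real (Suc n) \<le> 1" for n by simp
  then have v: "0 < v n z" "v n z \<le> exp c" "v n \<in> borel_measurable borel" for n z
    using u b[of z] unfolding v_def[abs_def] c
    by (auto simp: less_max_iff_disj intro: max.coboundedI1 max.coboundedI2)
  have v1: "v n z = 1" if "z \<notin> ?W" for n z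
    using off[OF that] by (simp add: v_def)
  have v_lim: "(\<lambda>n. v n z) \<longlonglongrightarrow> u z" for z
  proof -
    have "(\<lambda>n. v n z) \<longlonglongrightarrow> max (u z) 0"
      unfolding v_def by (intro tendsto_max tendsto_const LIMSEQ_Suc lim_1_over_n)
    then show ?thesis using nn[of z] by (simp add: max_absorb1)
  qed
  have meas_v: "(\<lambda>\<omega>. \<Prod>z\<in>\<omega> \<inter> ?W. v n z) \<in> borel_measurable \<pi>"
    and eq: "(\<integral>\<omega>. (\<Prod>z\<in>\<omega> \<inter> ?W. v n z) \<partial>\<pi>) = exp (\<integral>z. (v n z - 1) \<partial>\<sigma>)" for n
  proof -
    have [simp]: "min c (ln (v n z)) = ln (v n z)" for z
      using v(1,2)[of n z] by (intro min_absorb2) (metis exp_le_cancel_iff exp_ln)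
    have exps: "exp (\<Sum>z\<in>\<omega> \<inter> ?W. ln (v n z)) = (\<Prod>z\<in>\<omega> \<inter> ?W. v n z)" if "\<omega> \<in> space \<pi>" for \<omega>
      using v(1) finite_points[OF that U(2)] by (simp add: exp_sum)
    have ln: "(\<lambda>z. ln (v n z)) \<in> borel_measurable borel"
      using v(3)[of n] by measurable
    have "(\<lambda>\<omega>. exp (\<Sum>z\<in>\<omega> \<inter> ?W. ln (v n z))) \<in> borel_measurable \<pi>"
      using ln by (intro measurable_compose[OF borel_measurable_sum_poisson[OF U]]) auto
    then show "(\<lambda>\<omega>. \<Prod>z\<in>\<omega> \<inter> ?W. v n z) \<in> borel_measurable \<pi>"
      using exps by (simp cong: measurable_cong)
    show "(\<integral>\<omega>. (\<Prod>z\<in>\<omega> \<inter> ?W. v n z) \<partial>\<pi>) = exp (\<integral>z. (v n z - 1) \<partial>\<sigma>)"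
      using laplace_bounded_above[OF U ln _ c(1)] v1 v(1)
      by (simp add: exps cong: Bochner_Integration.integral_cong)
  qed
  have lim_prod: "(\<lambda>n. \<Prod>z\<in>\<omega> \<inter> ?W. v n z) \<longlonglongrightarrow> (\<Prod>z\<in>\<omega> \<inter> ?W. u z)" for \<omega>
    by (intro tendsto_prod v_lim)
  have meas: "(\<lambda>\<omega>. \<Prod>z\<in>\<omega> \<inter> ?W. u z) \<in> borel_measurable \<pi>"
    by (rule borel_measurable_LIMSEQ_real[OF lim_prod meas_v])
  have dom: "norm (\<Prod>z\<in>\<omega> \<inter> ?W. v n z) \<le> exp (\<Sum>z\<in>\<omega> \<inter> ?W. c)" if "\<omega> \<in> space \<pi>" for \<omega> n
  proof -
    have "norm (\<Prod>z\<in>\<omega> \<inter> ?W. v n z) \<le> (\<Prod>z\<in>\<omega> \<inter> ?W. exp c)"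
      unfolding real_norm_def abs_prod using v[of n] by (intro prod_mono) (auto simp: less_imp_le)
    also have "\<dots> = exp (\<Sum>z\<in>\<omega> \<inter> ?W. c)"
      by (simp add: exp_of_nat_mult)
    finally show ?thesis .
  qed
  have int: "integrable \<pi> (\<lambda>\<omega>. \<Prod>z\<in>\<omega> \<inter> ?W. u z)"
  proof (rule integrable_dominated_convergence[OF meas _ integrable_exp_count[OF U c(1)]])
    show "AE \<omega> in \<pi>. (\<lambda>n. \<Prod>z\<in>\<omega> \<inter> ?W. v n z) \<longlonglongrightarrow> (\<Prod>z\<in>\<omega> \<inter> ?W. u z)"
      by (intro AE_I2 lim_prod)
  qed (use meas_v dom in auto)
  have "(\<lambda>n. \<integral>\<omega>. (\<Prod>z\<in>\<omega> \<inter> ?W. v n z) \<partial>\<pi>) \<longlonglongrightarrow> (\<integral>\<omega>. (\<Prod>z\<in>\<omega> \<inter> ?W. u z) \<partial>\<pi>)"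
  proof (rule integral_dominated_convergence[OF meas meas_v integrable_exp_count[OF U c(1)]])
    show "AE \<omega> in \<pi>. (\<lambda>n. \<Prod>z\<in>\<omega> \<inter> ?W. v n z) \<longlonglongrightarrow> (\<Prod>z\<in>\<omega> \<inter> ?W. u z)"
      by (intro AE_I2 lim_prod)
  qed (use dom in auto)
  moreover have "(\<lambda>n. \<integral>z. (v n z - 1) \<partial>\<sigma>) \<longlonglongrightarrow> (\<integral>z. (u z - 1) \<partial>\<sigma>)"
  proof (rule integral_dominated_convergence[where w = "\<lambda>z. exp c * indicator ?W z"])
    show "integrable \<sigma> (\<lambda>z. exp c * indicator ?W z)"
      using emeasure_cylinder_finite[OF U(2)] cylinder_sets[OF U(1)] by simp
    show "(\<lambda>z. u z - 1) \<in> borel_measurable \<sigma>" "\<And>n. (\<lambda>z. v n z - 1) \<in> borel_measurable \<sigma>"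
      using u v(3) by (auto simp: measurable_cong_sets[OF sets_intensity refl])
    show "AE z in \<sigma>. (\<lambda>n. v n z - 1) \<longlonglongrightarrow> u z - 1"
      by (intro AE_I2 tendsto_diff tendsto_const v_lim)
    show "AE z in \<sigma>. norm (v n z - 1) \<le> exp c * indicator ?W z" for n
    proof (rule AE_I2)
      fix z
      have "\<bar>v n z - 1\<bar> \<le> exp c"
        using v(1,2)[of n z] c by linarith
      then show "norm (v n z - 1) \<le> exp c * indicator ?W z"
        using v1[of z n] by (cases "z \<in> ?W") auto
    qed
  qed
  then have "(\<lambda>n. exp (\<integral>z. (v n z - 1) \<partial>\<sigma>)) \<longlonglongrightarrow> exp (\<integral>z. (u z - 1) \<partial>\<sigma>)"
    by (rule tendsto_exp)
  ultimately have "(\<integral>\<omega>. (\<Prod>z\<in>\<omega> \<inter> ?W. u z) \<partial>\<pi>) = exp (\<integral>z. (u z - 1) \<partial>\<sigma>)"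
    unfolding eq using LIMSEQ_unique by blast
  with int show ?thesis
    by (simp add: has_bochner_integral_iff)
qed

section \<open>Products with unbounded factors\<close>

lemma borel_measurable_prod_poisson:
  fixes u :: "'x \<times> 'm \<Rightarrow> real"
  assumes U: "open U" "compact (closure U)" and u: "u \<in> borel_measurable borel"
    and nn: "\<And>z. 0 \<le> u z" and off: "\<And>z. z \<notin> U \<times> UNIV \<Longrightarrow> u z = 1"
  shows "(\<lambda>\<omega>. \<Prod>z\<in>\<omega> \<inter> U \<times> UNIV. u z) \<in> borel_measurable \<pi>"
proof (rule borel_measurable_LIMSEQ_real)
  fix n :: nat
  have "has_bochner_integral \<pi> (\<lambda>\<omega>. \<Prod>z\<in>\<omega> \<inter> U \<times> UNIV. min (u z) (real (Suc n)))
      (exp (\<integral>z. (min (u z) (real (Suc n)) - 1) \<partial>\<sigma>))"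
    using u nn off by (intro integral_prod_bounded[OF U, where b = "real (Suc n)"]) auto
  then show "(\<lambda>\<omega>. \<Prod>z\<in>\<omega> \<inter> U \<times> UNIV. min (u z) (real (Suc n))) \<in> borel_measurable \<pi>"
    by (rule borel_measurable_has_bochner_integral)
next
  fix \<omega>
  have "(\<lambda>n. min (u z) (real (Suc n))) \<longlonglongrightarrow> u z" for z
  proof -
    obtain m where "u z \<le> real m" using real_arch_simple by blast
    then show ?thesis
      by (intro tendsto_eventually) (auto simp: eventually_sequentially min_def intro!: exI[of _ m])
  qed
  then show "(\<lambda>n. \<Prod>z\<in>\<omega> \<inter> U \<times> UNIV. min (u z) (real (Suc n))) \<longlonglongrightarrow> (\<Prod>z\<in>\<omega> \<inter> U \<times> UNIV. u z)"
    by (intro tendsto_prod)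
qed

text \<open>A density need not be bounded, so it is truncated from above. Under \<pi> the products
  increase with the level, and monotone convergence applies without any prior integrability; under
  \<sigma> the integrands are dominated by \<open>\<bar>u z - 1\<bar>\<close>.\<close>

lemma nn_integral_prod:
  fixes u :: "'x \<times> 'm \<Rightarrow> real"
  assumes U: "open U" "compact (closure U)" and u: "u \<in> borel_measurable borel"
    and nn: "\<And>z. 0 \<le> u z" and off: "\<And>z. z \<notin> U \<times> UNIV \<Longrightarrow> u z = 1"
    and int: "integrable \<sigma> (\<lambda>z. u z - 1)"
  shows "(\<integral>\<^sup>+\<omega>. ennreal (\<Prod>z\<in>\<omega> \<inter> U \<times> UNIV. u z) \<partial>\<pi>) = ennreal (exp (\<integral>z. (u z - 1) \<partial>\<sigma>))"
proof -
  let ?W = "U \<times> (UNIV :: 'm set)"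
  \<comment> \<open>\<open>Suc n\<close> rather than \<open>n\<close>: a level below 1 would spoil
    the value 1 off the cylinder, and only levels of at least 1 never move a value further away from
    1, as the domination requires.\<close>
  define v where "v n z = min (u z) (real (Suc n))" for n z
  have v: "0 \<le> v n z" "v n z \<le> real (Suc n)" "z \<notin> ?W \<Longrightarrow> v n z = 1" "v n \<in> borel_measurable borel" for n z
    using u nn off by (auto simp: v_def[abs_def])
  have v_lim: "(\<lambda>n. v n z) \<longlonglongrightarrow> u z" for z
  proof -
    obtain m where "u z \<le> real m" using real_arch_simple by blast
    then show ?thesis
      by (intro tendsto_eventually) (auto simp: v_def eventually_sequentially min_def intro!: exI[of _ m])
  qed
  have hb: "has_bochner_integral \<pi> (\<lambda>\<omega>. \<Prod>z\<in>\<omega> \<inter> ?W. v n z) (exp (\<integral>z. (v n z - 1) \<partial>\<sigma>))" for n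
    using v by (intro integral_prod_bounded[OF U, where b = "real (Suc n)"]) auto
  have "(\<integral>\<^sup>+\<omega>. ennreal (\<Prod>z\<in>\<omega> \<inter> ?W. v n z) \<partial>\<pi>) = ennreal (exp (\<integral>z. (v n z - 1) \<partial>\<sigma>))" for n
    using hb[of n] v(1) by (subst nn_integral_eq_integral) (auto simp: has_bochner_integral_iff intro!: prod_nonneg)
  moreover have "(\<lambda>n. \<integral>\<^sup>+\<omega>. ennreal (\<Prod>z\<in>\<omega> \<inter> ?W. v n z) \<partial>\<pi>) \<longlonglongrightarrow> (\<integral>\<^sup>+\<omega>. ennreal (\<Prod>z\<in>\<omega> \<inter> ?W. u z) \<partial>\<pi>)"
  proof (rule nn_integral_LIMSEQ)
    show "mono (\<lambda>n \<omega>. ennreal (\<Prod>z\<in>\<omega> \<inter> ?W. v n z))"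
      using nn by (intro monoI le_funI ennreal_leI prod_mono) (auto simp: v_def)
    show "(\<lambda>\<omega>. ennreal (\<Prod>z\<in>\<omega> \<inter> ?W. v n z)) \<in> borel_measurable \<pi>" for n
      using hb[of n] by (auto simp: has_bochner_integral_iff)
    show "(\<lambda>n. ennreal (\<Prod>z\<in>\<omega> \<inter> ?W. v n z)) \<longlonglongrightarrow> ennreal (\<Prod>z\<in>\<omega> \<inter> ?W. u z)" for \<omega>
      by (intro tendsto_ennrealI tendsto_prod v_lim)
  qed
  moreover have "(\<lambda>n. \<integral>z. (v n z - 1) \<partial>\<sigma>) \<longlonglongrightarrow> (\<integral>z. (u z - 1) \<partial>\<sigma>)"
  proof (rule integral_dominated_convergence)
    show "integrable \<sigma> (\<lambda>z. \<bar>u z - 1\<bar>)" using int by simp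
    show "(\<lambda>z. u z - 1) \<in> borel_measurable \<sigma>" "\<And>n. (\<lambda>z. v n z - 1) \<in> borel_measurable \<sigma>"
      using u v(4) by (auto simp: measurable_cong_sets[OF sets_intensity refl])
    show "AE z in \<sigma>. (\<lambda>n. v n z - 1) \<longlonglongrightarrow> u z - 1"
      by (intro AE_I2 tendsto_diff tendsto_const v_lim)
    show "AE z in \<sigma>. norm (v n z - 1) \<le> \<bar>u z - 1\<bar>" for n
      by (intro AE_I2) (auto simp: v_def)
  qed
  then have "(\<lambda>n. ennreal (exp (\<integral>z. (v n z - 1) \<partial>\<sigma>))) \<longlonglongrightarrow> ennreal (exp (\<integral>z. (u z - 1) \<partial>\<sigma>))"
    by (intro tendsto_ennrealI tendsto_exp)
  ultimately show ?thesis
    by (simp only:) (rule LIMSEQ_unique)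
qed

text \<open>A single point of \<open>B\<close> contributes the factor 0. Thus restriction to a void
  event is again a multiplicative functional, and the product formula applies to it.\<close>

lemma prod_void:
  fixes u :: "'x \<times> 'm \<Rightarrow> real"
  assumes "\<omega> \<in> space \<pi>" "compact (closure U)" "B \<subseteq> U \<times> UNIV"
  shows "(\<Prod>z\<in>\<omega> \<inter> U \<times> UNIV. u z * (1 - indicator B z)) =
    (\<Prod>z\<in>\<omega> \<inter> U \<times> UNIV. u z) * indicator {\<omega> \<in> marked_configurations. \<omega> \<inter> B = {}} \<omega>"
proof (cases "\<omega> \<inter> B = {}")
  case True
  then have "(\<Prod>z\<in>\<omega> \<inter> U \<times> UNIV. u z * (1 - indicator B z)) = (\<Prod>z\<in>\<omega> \<inter> U \<times> UNIV. u z)"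
    by (intro prod.cong) (auto simp: indicator_def)
  with True assms(1) show ?thesis by (simp add: space_poisson)
next
  case False
  then obtain z where "z \<in> \<omega>" "z \<in> B" by auto
  then have "(\<Prod>z\<in>\<omega> \<inter> U \<times> UNIV. u z * (1 - indicator B z)) = 0"
    using assms by (intro prod_zero finite_points) (auto intro!: bexI[of _ z])
  with False show ?thesis by simp
qed

section \<open>Void probabilities and avoidance of null sets\<close>

lemma emeasure_void:
  assumes U: "open U" "compact (closure U)" and B: "B \<in> sets borel" "B \<subseteq> U \<times> UNIV"
  shows "emeasure \<pi> {\<omega> \<in> marked_configurations. \<omega> \<inter> B = {}} = ennreal (exp (- measure \<sigma> B))"
proof -
  let ?W = "U \<times> (UNIV :: 'm set)" and ?V = "{\<omega> \<in> marked_configurations. \<omega> \<inter> B = {}}"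
  have fin: "emeasure \<sigma> B < \<infinity>"
    using emeasure_mono[OF B(2) cylinder_sets[OF U(1)]] emeasure_cylinder_finite[OF U(2)] by (rule le_less_trans)
  have Bs: "B \<in> sets \<sigma>" using B by (simp add: sets_intensity)
  have "emeasure \<pi> ?V = (\<integral>\<^sup>+\<omega>. indicator ?V \<omega> \<partial>\<pi>)"
    using void_event_measurable[OF U B] by (simp add: sets_poisson)
  also have "\<dots> = (\<integral>\<^sup>+\<omega>. ennreal (\<Prod>z\<in>\<omega> \<inter> ?W. 1 - indicator B z) \<partial>\<pi>)"
    using prod_void[OF _ U(2) B(2), of _ "\<lambda>_. 1"] by (intro nn_integral_cong) (simp add: ennreal_indicator)
  also have "\<dots> = ennreal (exp (\<integral>z. ((1 - indicator B z) - 1) \<partial>\<sigma>))"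
  proof (rule nn_integral_prod[OF U])
    show "1 - indicator B z = (1 :: real)" if "z \<notin> ?W" for z
      using B(2) that by (auto simp: indicator_def)
    show "integrable \<sigma> (\<lambda>z. (1 - indicator B z) - 1 :: real)"
      using fin Bs by simp
  qed (use B in \<open>auto simp: indicator_def\<close>)
  also have "(\<integral>z. ((1 - indicator B z) - 1 :: real) \<partial>\<sigma>) = - measure \<sigma> B"
    using Bs by (simp add: space_intensity)
  finally show ?thesis .
qed

text \<open>Turns a property of \<sigma>-almost every point into a property of all points of almost
  every configuration. It is applied to the points where the density is infinite and to those where
  it vanishes.\<close>

lemma AE_void:
  assumes U: "open U" "compact (closure U)" and B: "B \<in> null_sets \<sigma>" "B \<subseteq> U \<times> UNIV"
  shows "AE \<omega> in \<pi>. \<omega> \<inter> B = {}"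
proof -
  let ?V = "{\<omega> \<in> marked_configurations. \<omega> \<inter> B = {}}"
  have Bs: "B \<in> sets borel"
    using null_setsD2[OF B(1)] by (simp only: sets_intensity)
  have "emeasure \<pi> ?V = 1"
    unfolding emeasure_void[OF U Bs B(2)] measure_def null_setsD1[OF B(1)] by simp
  then have "prob ?V = 1"
    by (simp add: measure_def)
  then have "AE \<omega> in \<pi>. \<omega> \<in> ?V"
    by (rule AE_prob_1)
  then show ?thesis
    by (rule AE_mp) (rule AE_I2, simp)
qed

end

section \<open>Transformed Poisson measures\<close>

context poisson_configurations
begin

lemma sigma_finite_intensity: "sigma_finite_measure \<sigma>"
proof
  obtain U :: "nat \<Rightarrow> 'x set" where U: "\<And>n. open (U n)" "\<And>n. compact (closure (U n))" "(\<Union>n. U n) = UNIV"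
    using relatively_compact_open_cover[OF lcX] by auto
  let ?A = "range (\<lambda>n. U n \<times> (UNIV :: 'm set))"
  have "\<Union>?A = (\<Union>n. U n) \<times> UNIV" by auto
  then have "\<Union>?A = space \<sigma>"
    using U(3) by (simp add: space_intensity)
  moreover have "?A \<subseteq> sets \<sigma>"
    using cylinder_sets[OF U(1)] by auto
  moreover have "\<forall>a\<in>?A. emeasure \<sigma> a \<noteq> \<infinity>"
    using emeasure_cylinder_finite[OF U(2)] by (auto simp: less_top)
  ultimately show "\<exists>A. countable A \<and> A \<subseteq> sets \<sigma> \<and> \<Union>A = space \<sigma> \<and> (\<forall>a\<in>A. emeasure \<sigma> a \<noteq> \<infinity>)"
    by (intro exI[of _ ?A]) simp
qed

end

text \<open>What the product formula uses of a group element. Here \<open>pa\<close> is any version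
  of the density, given through the measure it defines, but its value 1 off the cylinder over
  \<open>K\<close> is exact: changing it on a null set would be harmless for \<sigma>, yet
  finiteness of the products relies on it for each configuration.\<close>

locale poisson_transformation = poisson_configurations \<sigma> \<pi>
  for \<sigma> :: "('a::{t2_space, second_countable_topology} \<times> 'b::{t2_space, second_countable_topology}) measure"
    and \<pi> :: "('a \<times> 'b) set measure" +
  fixes a :: "'a \<times> 'b \<Rightarrow> 'a \<times> 'b" and K :: "'a set" and pa :: "'a \<times> 'b \<Rightarrow> ennreal"
  assumes a_measurable: "a \<in> borel \<rightarrow>\<^sub>M borel"
    and a_config: "\<And>\<omega>. \<omega> \<in> marked_configurations \<Longrightarrow> a ` \<omega> \<in> marked_configurations"
    and compact_K: "compact K"
    and a_cylinder: "\<And>U. K \<subseteq> U \<Longrightarrow> a -` (U \<times> UNIV) = U \<times> UNIV"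
    and pa_measurable: "pa \<in> borel_measurable borel"
    and pa_density: "density \<sigma> pa = distr \<sigma> \<sigma> a"
    and pa_off: "\<And>z. fst z \<notin> K \<Longrightarrow> pa z = 1"
begin

text \<open>The product formulas are stated over open relatively compact sets, so the compact set
  \<open>K\<close> is enlarged; the extra factors are all 1.\<close>

definition support_nbhd where "support_nbhd = (SOME U. open U \<and> compact (closure U) \<and> K \<subseteq> U)"

lemma support_nbhd: "open support_nbhd" "compact (closure support_nbhd)" "K \<subseteq> support_nbhd"
proof -
  have "\<exists>U. open U \<and> compact (closure U) \<and> K \<subseteq> U"
    using compact_relatively_compact_nbhd[OF lcX compact_K] by metis
  from someI_ex[OF this] show "open support_nbhd" "compact (closure support_nbhd)" "K \<subseteq> support_nbhd"
    by (auto simp: support_nbhd_def)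
qed

text \<open>\<open>enn2real\<close> sends an infinite value to 0. By \<open>pa_finite\<close> this
  alters the density only on a null set, and it allows real products and Bochner integrals.\<close>

definition point_density where "point_density z = enn2real (pa z)"

lemma point_density: "point_density \<in> borel_measurable borel" "0 \<le> point_density z" "fst z \<notin> K \<Longrightarrow> point_density z = 1"
  using pa_measurable pa_off by (auto simp: point_density_def[abs_def])

lemma a_vimage_sets: "B \<in> sets borel \<Longrightarrow> a -` B \<in> sets borel"
  using measurable_sets[OF a_measurable, of B] by simp

lemma nn_integral_pa:
  assumes "A \<in> sets borel"
  shows "(\<integral>\<^sup>+z. pa z * indicator A z \<partial>\<sigma>) = emeasure \<sigma> (a -` A)"
proof -
  have "(\<integral>\<^sup>+z. pa z * indicator A z \<partial>\<sigma>) = emeasure (density \<sigma> pa) A"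
    using assms pa_measurable
    by (subst emeasure_density) (auto simp: sets_intensity measurable_cong_sets[OF sets_intensity refl])
  also have "\<dots> = emeasure \<sigma> (a -` A)"
    unfolding pa_density using assms a_measurable
    by (subst emeasure_distr)
      (auto simp: sets_intensity space_intensity measurable_cong_sets[OF sets_intensity sets_intensity])
  finally show ?thesis .
qed

text \<open>The integral of \<open>pa\<close> over the cylinder is the \<sigma>-mass of its
  preimage, which is the cylinder itself and has finite mass. Outside, \<open>pa\<close> is
  1.\<close>

lemma pa_finite: "AE z in \<sigma>. pa z = ennreal (point_density z)"
proof -
  let ?W = "support_nbhd \<times> (UNIV :: 'b set)"
  have "(\<integral>\<^sup>+z. pa z * indicator ?W z \<partial>\<sigma>) = emeasure \<sigma> (a -` ?W)"
    using support_nbhd by (intro nn_integral_pa) (simp add: open_Times)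
  also have "\<dots> < \<infinity>"
    unfolding a_cylinder[OF support_nbhd(3)] by (rule emeasure_cylinder_finite[OF support_nbhd(2)])
  finally have "(\<integral>\<^sup>+z. pa z * indicator ?W z \<partial>\<sigma>) \<noteq> \<infinity>" by simp
  moreover have "(\<lambda>z. pa z * indicator ?W z) \<in> borel_measurable \<sigma>"
    using pa_measurable support_nbhd
    by (auto simp: measurable_cong_sets[OF sets_intensity refl] intro!: borel_measurable_times_ennreal borel_measurable_indicator borel_open open_Times)
  ultimately have "AE z in \<sigma>. pa z * indicator ?W z \<noteq> \<infinity>"
    by (rule nn_integral_PInf_AE[rotated])
  then show ?thesis
  proof (rule AE_mp, intro AE_I2 impI)
    fix z assume z: "pa z * indicator ?W z \<noteq> \<infinity>"
    show "pa z = ennreal (point_density z)"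
    proof (cases "z \<in> ?W")
      case True
      with z show ?thesis by (simp add: point_density_def less_top)
    next
      case False
      then have "fst z \<notin> K" using support_nbhd(3) by (auto simp: mem_Times_iff)
      then show ?thesis using pa_off point_density(3) by simp
    qed
  qed
qed

lemma integral_point_density:
  assumes U: "open U" "compact (closure U)" "K \<subseteq> U" and A: "A \<in> sets borel" "A \<subseteq> U \<times> UNIV"
  shows "has_bochner_integral \<sigma> (\<lambda>z. point_density z * indicator A z) (measure \<sigma> (a -` A))"
proof (rule has_bochner_integral_nn_integral)
  have "a -` A \<subseteq> U \<times> UNIV"
    using A(2) a_cylinder[OF U(3)] by auto
  then have "emeasure \<sigma> (a -` A) \<le> emeasure \<sigma> (U \<times> UNIV)"
    by (rule emeasure_mono) (rule cylinder_sets[OF U(1)])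
  also have "\<dots> < \<infinity>" by (rule emeasure_cylinder_finite[OF U(2)])
  finally have fin: "emeasure \<sigma> (a -` A) < \<infinity>" .
  have "(\<integral>\<^sup>+z. ennreal (point_density z * indicator A z) \<partial>\<sigma>) = (\<integral>\<^sup>+z. pa z * indicator A z \<partial>\<sigma>)"
    using pa_finite by (intro nn_integral_cong_AE) (auto elim!: eventually_mono simp: point_density(2) indicator_def)
  also have "\<dots> = ennreal (measure \<sigma> (a -` A))"
    using fin A by (simp add: nn_integral_pa emeasure_eq_ennreal_measure)
  finally show "(\<integral>\<^sup>+z. ennreal (point_density z * indicator A z) \<partial>\<sigma>) = ennreal (measure \<sigma> (a -` A))" .
  show "(\<lambda>z. point_density z * indicator A z) \<in> borel_measurable \<sigma>"
    using point_density(1) A by (simp add: measurable_cong_sets[OF sets_intensity refl])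
qed (use point_density(2) in auto)

definition configuration_density where "configuration_density \<omega> = ennreal (\<Prod>z\<in>\<omega> \<inter> support_nbhd \<times> UNIV. point_density z)"

lemma point_density_off_cylinder: "K \<subseteq> U \<Longrightarrow> z \<notin> U \<times> UNIV \<Longrightarrow> point_density z = 1"
  using point_density(3)[of z] by (auto simp: mem_Times_iff)

lemma configuration_density_measurable: "configuration_density \<in> borel_measurable \<pi>"
  unfolding configuration_density_def[abs_def] using borel_measurable_prod_poisson[OF support_nbhd(1,2) point_density(1,2) point_density_off_cylinder[OF support_nbhd(3)]]
  by simp

text \<open>The two products can differ only if \<omega> contains a point where \<open>pa\<close> is
  infinite. Such points form a null set inside the cylinder, so almost every \<omega> avoids
  them.\<close>

lemma configuration_density_eq_prod: "AE \<omega> in \<pi>. configuration_density \<omega> = (\<Prod>z\<in>{z\<in>\<omega>. pa z \<noteq> 1}. pa z)"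
proof -
  let ?N = "{z. pa z \<noteq> ennreal (point_density z)}"
  have "{z \<in> space borel. pa z \<noteq> ennreal (point_density z)} \<in> sets borel"
    using pa_measurable point_density(1) by measurable
  then have "?N \<in> sets \<sigma>"
    by (simp add: sets_intensity)
  then have "?N \<in> null_sets \<sigma>"
    using pa_finite by (simp add: AE_iff_null_sets)
  moreover have "?N \<subseteq> support_nbhd \<times> UNIV"
    using support_nbhd(3) pa_off point_density(3) by (force simp: mem_Times_iff)
  ultimately have "AE \<omega> in \<pi>. \<omega> \<inter> ?N = {}"
    by (rule AE_void[OF support_nbhd(1,2)])
  then show ?thesis
  proof (rule AE_mp, intro AE_I2 impI)
    fix \<omega> assume \<omega>: "\<omega> \<in> space \<pi>" "\<omega> \<inter> ?N = {}"
    have "configuration_density \<omega> = (\<Prod>z\<in>\<omega> \<inter> support_nbhd \<times> UNIV. ennreal (point_density z))"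
      using point_density(2) by (simp add: configuration_density_def prod_ennreal)
    also have "\<dots> = (\<Prod>z\<in>\<omega> \<inter> support_nbhd \<times> UNIV. pa z)"
      using \<omega>(2) by (intro prod.cong) auto
    also have "\<dots> = (\<Prod>z\<in>{z\<in>\<omega>. pa z \<noteq> 1}. pa z)"
    proof (rule prod.mono_neutral_right[OF finite_points[OF \<omega>(1) support_nbhd(2)]])
      show "{z \<in> \<omega>. pa z \<noteq> 1} \<subseteq> \<omega> \<inter> support_nbhd \<times> UNIV"
        using support_nbhd(3) pa_off by (force simp: mem_Times_iff)
    qed auto
    finally show "configuration_density \<omega> = (\<Prod>z\<in>{z\<in>\<omega>. pa z \<noteq> 1}. pa z)" .
  qed
qed

lemma configuration_density_cylinder:
  assumes "\<omega> \<in> space \<pi>" "compact (closure U)" "support_nbhd \<subseteq> U"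
  shows "configuration_density \<omega> = ennreal (\<Prod>z\<in>\<omega> \<inter> U \<times> UNIV. point_density z)"
  unfolding configuration_density_def
proof (rule arg_cong[of _ _ ennreal], rule prod.mono_neutral_left[OF finite_points[OF assms(1,2)]])
  show "\<forall>z\<in>\<omega> \<inter> U \<times> UNIV - \<omega> \<inter> support_nbhd \<times> UNIV. point_density z = 1"
    using point_density_off_cylinder[OF support_nbhd(3)] by blast
qed (use assms(3) in auto)

section \<open>The image of the Poisson measure and its density\<close>

lemma vimage_void:
  "(`) a -` {\<omega> \<in> marked_configurations. \<omega> \<inter> B = {}} \<inter> marked_configurations
    = {\<omega> \<in> marked_configurations. \<omega> \<inter> a -` B = {}}"
  using a_config by blast

lemma image_measurable: "(`) a \<in> \<pi> \<rightarrow>\<^sub>M \<pi>"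
proof (rule measurable_sigma_sets)
  show "sets \<pi> = sigma_sets marked_configurations void_events"
    by (simp add: sets_poisson sets_configuration_algebra_void_events[OF lcX])
  show "(void_events :: ('a \<times> 'b) set set set) \<subseteq> Pow marked_configurations"
    by (auto simp: void_events_def)
  show "(`) a \<in> space \<pi> \<rightarrow> marked_configurations"
    using a_config by (simp add: space_poisson)
  fix v :: "('a \<times> 'b) set set" assume "v \<in> void_events"
  then obtain B where B: "v = {\<omega> \<in> marked_configurations. \<omega> \<inter> B = {}}" "B \<in> sets borel" "compact (closure (fst ` B))"
    unfolding void_events_def by blast
  \<comment> \<open>Only cylinders over sets containing \<open>K\<close> are known to be invariant,
    so \<open>K\<close> is included to keep the preimage of \<open>B\<close> inside the same
    cylinder.\<close>
  have "compact (K \<union> closure (fst ` B))"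
    using compact_K B(3) by (rule compact_Un)
  then obtain U where U: "open U" "compact (closure U)" "K \<union> closure (fst ` B) \<subseteq> U"
    using compact_relatively_compact_nbhd[OF lcX] by metis
  then have "B \<subseteq> U \<times> UNIV"
    using closure_subset[of "fst ` B"] by force
  then have "a -` B \<subseteq> U \<times> UNIV"
    using a_cylinder[of U] U(3) by blast
  then show "(`) a -` v \<inter> space \<pi> \<in> sets \<pi>"
    unfolding B(1) space_poisson vimage_void sets_poisson
    by (rule void_event_measurable[OF U(1,2) a_vimage_sets[OF B(2)]])
qed

lemma distr_poisson: "distr \<pi> \<pi> ((`) a) = density \<pi> configuration_density"
proof (rule configuration_measure_eqI[OF lcX])
  show "finite_measure (distr \<pi> \<pi> ((`) a))"
    using prob_space_distr[OF image_measurable] by (rule prob_space.finite_measure)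
  show "sets (distr \<pi> \<pi> ((`) a)) = sets configuration_algebra" "sets (density \<pi> configuration_density) = sets configuration_algebra"
    by (simp_all add: sets_poisson)
  fix B :: "('a \<times> 'b) set" and U'
  assume U': "open U'" "compact (closure U')" and B': "B \<in> sets borel" "B \<subseteq> U' \<times> UNIV"
  let ?V = "{\<omega> \<in> marked_configurations. \<omega> \<inter> B = {}}"
  define U where "U = U' \<union> support_nbhd"
  let ?W = "U \<times> (UNIV :: 'b set)"
  have U: "open U" "compact (closure U)" "K \<subseteq> U" "support_nbhd \<subseteq> U"
    using U' support_nbhd by (auto simp: U_def compact_Un)
  have B: "B \<in> sets borel" "B \<subseteq> ?W"
    using B' by (auto simp: U_def)
  have aB: "a -` B \<in> sets borel" "a -` B \<subseteq> ?W"
    using a_vimage_sets[OF B(1)] B(2) a_cylinder[OF U(3)] by auto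
  have V: "?V \<in> sets \<pi>"
    unfolding sets_poisson by (rule void_event_measurable[OF U(1,2) B])
  have W: "?W \<in> sets borel" using U(1) by (simp add: open_Times)
  note hbB = integral_point_density[OF U(1-3) B]
  note hbW = integral_point_density[OF U(1-3) W order_refl, unfolded a_cylinder[OF U(3)]]
  have hb1: "has_bochner_integral \<sigma> (indicator ?W :: _ \<Rightarrow> real) (measure \<sigma> ?W)"
    using emeasure_cylinder_finite[OF U(2)] cylinder_sets[OF U(1)]
    by (intro has_bochner_integral_real_indicator) auto
  \<comment> \<open>The exponent is split into three separately integrable pieces. The first two
    have the same integral, so only the \<sigma>-mass of the preimage of \<open>B\<close> is
    left.\<close>
  have "has_bochner_integral \<sigma> (\<lambda>z. point_density z * indicator ?W z - indicator ?W z - point_density z * indicator B z)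
      (measure \<sigma> ?W - measure \<sigma> ?W - measure \<sigma> (a -` B))"
    by (intro has_bochner_integral_diff hbW hb1 hbB)
  also have "(\<lambda>z. point_density z * indicator ?W z - indicator ?W z - point_density z * indicator B z)
      = (\<lambda>z. point_density z * (1 - indicator B z) - 1)"
  proof
    fix z
    show "point_density z * indicator ?W z - indicator ?W z - point_density z * indicator B z = point_density z * (1 - indicator B z) - 1"
      using B(2) point_density_off_cylinder[OF U(3), of z] by (cases "z \<in> ?W") (auto simp: algebra_simps indicator_def)
  qed
  finally have hb: "has_bochner_integral \<sigma> (\<lambda>z. point_density z * (1 - indicator B z) - 1) (- measure \<sigma> (a -` B))"
    by simp
  have "emeasure (density \<pi> configuration_density) ?V = (\<integral>\<^sup>+\<omega>. configuration_density \<omega> * indicator ?V \<omega> \<partial>\<pi>)"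
    using V by (intro emeasure_density configuration_density_measurable)
  also have "\<dots> = (\<integral>\<^sup>+\<omega>. ennreal (\<Prod>z\<in>\<omega> \<inter> ?W. point_density z * (1 - indicator B z)) \<partial>\<pi>)"
  proof (rule nn_integral_cong)
    fix \<omega> assume \<omega>: "\<omega> \<in> space \<pi>"
    show "configuration_density \<omega> * indicator ?V \<omega> = ennreal (\<Prod>z\<in>\<omega> \<inter> ?W. point_density z * (1 - indicator B z))"
      unfolding prod_void[OF \<omega> U(2) B(2)] configuration_density_cylinder[OF \<omega> U(2,4)]
      by (simp add: indicator_def)
  qed
  also have "\<dots> = ennreal (exp (\<integral>z. (point_density z * (1 - indicator B z) - 1) \<partial>\<sigma>))"
  proof (rule nn_integral_prod[OF U(1,2)])
    show "(\<lambda>z. point_density z * (1 - indicator B z)) \<in> borel_measurable borel"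
      using point_density(1) B(1) by measurable
    show "0 \<le> point_density z * (1 - indicator B z)" for z
      using point_density(2)[of z] by (simp add: indicator_def)
    show "point_density z * (1 - indicator B z) = 1" if "z \<notin> ?W" for z
      using point_density_off_cylinder[OF U(3) that] B(2) that by (auto simp: indicator_def)
    show "integrable \<sigma> (\<lambda>z. point_density z * (1 - indicator B z) - 1)"
      using hb by (simp add: has_bochner_integral_iff)
  qed
  also have "\<dots> = ennreal (exp (- measure \<sigma> (a -` B)))"
    using hb by (simp add: has_bochner_integral_iff)
  also have "\<dots> = emeasure \<pi> {\<omega> \<in> marked_configurations. \<omega> \<inter> a -` B = {}}"
    by (rule emeasure_void[OF U(1,2) aB, symmetric])
  also have "\<dots> = emeasure (distr \<pi> \<pi> ((`) a)) ?V"
    unfolding emeasure_distr[OF image_measurable V] space_poisson vimage_void ..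
  finally show "emeasure (distr \<pi> \<pi> ((`) a)) ?V = emeasure (density \<pi> configuration_density) ?V" ..
qed

lemma RN_deriv_poisson:
  "AE \<omega> in \<pi>. RN_deriv \<pi> (distr \<pi> \<pi> ((`) a)) \<omega> = (\<Prod>z\<in>{z\<in>\<omega>. pa z \<noteq> 1}. pa z)"
  using RN_deriv_unique[OF configuration_density_measurable distr_poisson[symmetric]] configuration_density_eq_prod
  by eventually_elim simp

text \<open>For the second claim the configuration density must be positive almost surely. The zeros
  of the point density are null for the image of \<sigma>, hence for \<sigma> by \<open>ac\<close>;
  almost every configuration avoids them and has only positive factors.\<close>

lemma quasi_invariant_poisson:
  assumes ac: "absolutely_continuous (distr \<sigma> \<sigma> a) \<sigma>"
  shows "absolutely_continuous \<pi> (distr \<pi> \<pi> ((`) a))" "absolutely_continuous (distr \<pi> \<pi> ((`) a)) \<pi>"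
proof -
  show "absolutely_continuous \<pi> (distr \<pi> \<pi> ((`) a))"
    unfolding distr_poisson by (rule absolutely_continuousI_density[OF configuration_density_measurable])
  let ?N = "{z. point_density z = 0}"
  have "{z \<in> space borel. point_density z = 0} \<in> sets borel"
    using point_density(1) by measurable
  then have Ns: "?N \<in> sets \<sigma>" by (simp add: sets_intensity)
  \<comment> \<open>The real version vanishes also where \<open>pa\<close> is infinite, so the
    integrand is 0 only almost everywhere.\<close>
  have "(\<integral>\<^sup>+z. pa z * indicator ?N z \<partial>\<sigma>) = (\<integral>\<^sup>+z. 0 \<partial>\<sigma>)"
    using pa_finite by (intro nn_integral_cong_AE) (auto elim!: eventually_mono simp: indicator_def)
  then have "emeasure (density \<sigma> pa) ?N = 0"
    using Ns pa_measurable
    by (subst emeasure_density) (auto simp: measurable_cong_sets[OF sets_intensity refl])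
  then have "?N \<in> null_sets (distr \<sigma> \<sigma> a)"
    using Ns unfolding pa_density[symmetric] by (auto simp: null_sets_def)
  then have "?N \<in> null_sets \<sigma>"
    using ac by (auto simp: absolutely_continuous_def)
  moreover have "?N \<subseteq> support_nbhd \<times> UNIV"
    using point_density_off_cylinder[OF support_nbhd(3)] by force
  ultimately have "AE \<omega> in \<pi>. \<omega> \<inter> ?N = {}"
    by (rule AE_void[OF support_nbhd(1,2)])
  then have pos: "AE \<omega> in \<pi>. 0 < configuration_density \<omega>"
  proof (rule AE_mp, intro AE_I2 impI)
    fix \<omega> assume \<omega>: "\<omega> \<in> space \<pi>" "\<omega> \<inter> ?N = {}"
    have "0 < point_density z" if "z \<in> \<omega>" for z
      using \<omega>(2) that point_density(2)[of z] by (auto simp: less_le)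
    then show "0 < configuration_density \<omega>"
      by (auto simp: configuration_density_def intro!: prod_pos)
  qed
  show "absolutely_continuous (distr \<pi> \<pi> ((`) a)) \<pi>"
    unfolding absolutely_continuous_def
  proof
    fix A assume "A \<in> null_sets (distr \<pi> \<pi> ((`) a))"
    then have "A \<in> sets \<pi>" "AE \<omega> in \<pi>. \<omega> \<in> A \<longrightarrow> configuration_density \<omega> = 0"
      unfolding distr_poisson null_sets_density_iff[OF configuration_density_measurable] by auto
    moreover from this(2) pos have "AE \<omega> in \<pi>. \<omega> \<notin> A"
      by eventually_elim auto
    ultimately show "A \<in> null_sets \<pi>"
      by (simp add: AE_iff_null_sets)
  qed
qed

end

section \<open>Riemannian volume and diffeomorphisms\<close>

lemma chart_homeomorphism:
  assumes "is_chart c"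
  shows "open (fst c)" "open (snd c ` fst c)" "continuous_on (fst c) (snd c)"
    "continuous_on (snd c ` fst c) (chart_inv c)" "\<And>x. x \<in> fst c \<Longrightarrow> chart_inv c (snd c x) = x"
    "\<And>y. y \<in> snd c ` fst c \<Longrightarrow> snd c (chart_inv c y) = y"
    "\<And>y. y \<in> snd c ` fst c \<Longrightarrow> chart_inv c y \<in> fst c"
  using assms by (auto simp: is_chart_def homeomorphism_def)

lemma locally_compact_smooth_manifold:
  fixes A :: "('x::topological_space, 'e::{real_normed_vector, heine_borel}) chart set"
  assumes "smooth_atlas A"
  shows "locally_compact_space (euclidean :: 'x topology)"
  unfolding locally_compact_space_def
proof
  fix x :: 'x
  have "x \<in> (\<Union>c\<in>A. fst c)"
    using assms by (simp add: smooth_atlas_def)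
  then obtain c where c: "c \<in> A" "x \<in> fst c"
    by blast
  with assms have "is_chart c" by (auto simp: smooth_atlas_def)
  note ch = chart_homeomorphism[OF this]
  have "snd c x \<in> snd c ` fst c" using c by simp
  then obtain e where e: "0 < e" "cball (snd c x) e \<subseteq> snd c ` fst c"
    using ch(2) open_contains_cball by blast
  let ?V = "fst c \<inter> snd c -` ball (snd c x) e" and ?K = "chart_inv c ` cball (snd c x) e"
  have "compact ?K"
    using ch(4) e(2) by (intro compact_continuous_image compact_cball) (rule continuous_on_subset)
  moreover have "open ?V"
    using ch(1,3) by (intro continuous_open_preimage) auto
  moreover have "x \<in> ?V" using c e by simp
  moreover have "?V \<subseteq> ?K"
  proof
    fix z assume z: "z \<in> ?V"
    then have "z = chart_inv c (snd c z)" using ch(5) by simp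
    with z show "z \<in> ?K" by (intro image_eqI[of _ _ "snd c z"]) auto
  qed
  ultimately show "\<exists>U K. openin euclidean U \<and> compactin euclidean K \<and> x \<in> U \<and> U \<subseteq> K"
    unfolding open_openin[symmetric] compactin_euclidean_iff by blast
qed

text \<open>The determinant does not vanish on the segment from the identity to the given matrix.\<close>

lemma det_positive_definite:
  fixes A :: "real ^ 'n ^ 'n"
  assumes pos: "\<And>v. v \<noteq> 0 \<Longrightarrow> 0 < v \<bullet> (A *v v)"
  shows "0 < det A"
proof (rule ccontr)
  assume "\<not> 0 < det A"
  \<comment> \<open>The segment from the identity to \<open>A\<close>. A singular matrix on it has a
    kernel vector, at which its quadratic form is 0 although it is a convex combination of two
    positive numbers.\<close>
  define B where "B t = t *\<^sub>R A + (1 - t) *\<^sub>R mat 1" for t :: real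
  have "continuous_on {0..1} (\<lambda>t. det (B t))"
    unfolding det_def B_def by (intro continuous_intros)
  moreover have "det (B 0) = 1" "det (B 1) \<le> 0"
    using \<open>\<not> 0 < det A\<close> by (simp_all add: B_def)
  ultimately obtain t where t: "0 \<le> t" "t \<le> 1" "det (B t) = 0"
    using IVT2'[of "\<lambda>t. det (B t)" 1 0 0] by auto
  then obtain v where v: "v \<noteq> 0" "B t *v v = 0"
    using matrix_left_invertible_ker[of "B t"] invertible_det_nz[of "B t"] invertible_left_inverse[of "B t"] by auto
  have "B t *v v = t *\<^sub>R (A *v v) + (1 - t) *\<^sub>R v"
    by (simp add: B_def matrix_vector_mult_add_rdistrib scaleR_matrix_vector_assoc[symmetric])
  then have "0 = t * (v \<bullet> (A *v v)) + (1 - t) * (v \<bullet> v)"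
    using v(2) by (metis inner_add_right inner_scaleR_right inner_zero_right)
  moreover have "0 < v \<bullet> (A *v v)" "0 < v \<bullet> v"
    using pos[OF v(1)] v(1) by simp_all
  moreover from this have "0 \<le> t * (v \<bullet> (A *v v))" "0 \<le> (1 - t) * (v \<bullet> v)"
    using t(1,2) by simp_all
  ultimately show False
    by (cases "t = 0") (simp_all add: add_nonneg_eq_0_iff)
qed

lemma riemannian_metric_det_pos:
  fixes A :: "('x::topological_space, real ^ 'n) chart set"
  assumes g: "riemannian_metric A g" and c: "c \<in> A" and y: "y \<in> snd c ` fst c"
  shows "0 < det (\<chi> i j. g c y (axis i 1) (axis j 1))"
proof (rule det_positive_definite)
  fix v :: "real ^ 'n" assume "v \<noteq> 0"
  have bil: "bilinear (g c y)" and pos: "0 < g c y v v"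
    using assms \<open>v \<noteq> 0\<close> by (auto simp: riemannian_metric_def)
  have v: "v = (\<Sum>i\<in>UNIV. (v $ i) *\<^sub>R axis i 1)"
    using basis_expansion[of v] by (simp add: scalar_mult_eq_scaleR)
  have "g c y v v = g c y (\<Sum>i\<in>UNIV. (v $ i) *\<^sub>R axis i 1) (\<Sum>i\<in>UNIV. (v $ i) *\<^sub>R axis i 1)"
    using v by simp
  also have "\<dots> = (\<Sum>(i, j)\<in>UNIV \<times> UNIV. g c y ((v $ i) *\<^sub>R axis i 1) ((v $ j) *\<^sub>R axis j 1))"
    using bil by (rule bilinear_sum)
  also have "\<dots> = (\<Sum>i\<in>UNIV. \<Sum>j\<in>UNIV. v $ i * (v $ j * g c y (axis i 1) (axis j 1)))"
    using bil by (simp add: sum.cartesian_product bilinear_lmul bilinear_rmul)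
  also have "\<dots> = v \<bullet> ((\<chi> i j. g c y (axis i 1) (axis j 1)) *v v)"
    by (simp add: inner_vec_def matrix_vector_mult_def sum_distrib_left ac_simps)
  finally show "0 < v \<bullet> ((\<chi> i j. g c y (axis i 1) (axis j 1)) *v v)"
    using pos by simp
qed

lemma borel_chart_image:
  fixes c :: "('x::topological_space, 'e::real_normed_vector) chart"
  assumes c: "is_chart c" and B: "B \<in> sets borel" "B \<subseteq> fst c"
  shows "snd c ` B \<in> sets borel"
proof -
  note ch = chart_homeomorphism[OF c]
  have "chart_inv c \<in> borel_measurable (restrict_space borel (snd c ` fst c))"
    using ch(4) by (rule borel_measurable_continuous_on_restrict)
  from measurable_sets[OF this B(1)]
  have "chart_inv c -` B \<inter> snd c ` fst c \<in> sets (restrict_space borel (snd c ` fst c))"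
    by (simp add: space_restrict_space)
  then have "chart_inv c -` B \<inter> snd c ` fst c \<in> sets borel"
    using ch(2) by (subst (asm) sets_restrict_space_iff) auto
  also have "chart_inv c -` B \<inter> snd c ` fst c = snd c ` B"
    using ch(5,6,7) B(2) by (auto simp: image_iff)
  finally show ?thesis .
qed

lemma smooth_on_imp_continuous_on: "smooth_on S f \<Longrightarrow> continuous_on S f"
  unfolding smooth_on_def by (metis ck_on.simps(1))

text \<open>The coordinate density of the volume is strictly positive, so null sets are exactly the
  Lebesgue-null sets in coordinates. Absolute continuity is all that is asked of the volume, and it
  depends on null sets only.\<close>

lemma riemannian_volume_null_iff:
  fixes A :: "('x::topological_space, real ^ 'n) chart set"
  assumes A: "smooth_atlas A" and g: "riemannian_metric A g" and \<nu>: "riemannian_volume A g \<nu>"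
    and c: "c \<in> A" and B: "B \<in> sets borel" "B \<subseteq> fst c"
  shows "emeasure \<nu> B = 0 \<longleftrightarrow> negligible (snd c ` B)"
proof -
  let ?w = "\<lambda>y. ennreal (sqrt (det (\<chi> i j. g c y (axis i 1) (axis j 1))))"
  let ?O = "snd c ` fst c" and ?S = "snd c ` B"
  have chart: "is_chart c" using A c by (simp add: smooth_atlas_def)
  note ch = chart_homeomorphism[OF chart]
  have S: "?S \<in> sets borel" "?S \<subseteq> ?O"
    using borel_chart_image[OF chart B] B(2) by auto
  have "continuous_on ?O (\<lambda>y. g c y v w)" for v w
    using g c by (auto simp: riemannian_metric_def intro: smooth_on_imp_continuous_on)
  then have "continuous_on ?O (\<lambda>y. sqrt (det (\<chi> i j. g c y (axis i 1) (axis j 1))))"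
    unfolding det_def by (intro continuous_intros) simp
  then have "continuous_on ?S (\<lambda>y. sqrt (det (\<chi> i j. g c y (axis i 1) (axis j 1))))"
    using S(2) by (rule continuous_on_subset)
  \<comment> \<open>Continuity of the metric coefficients is known only on the chart image, so the
    integrand is cut to \<open>?S\<close> before it is measurable on the whole model space.\<close>
  then have "(\<lambda>y. indicator ?S y *\<^sub>R sqrt (det (\<chi> i j. g c y (axis i 1) (axis j 1)))) \<in> borel_measurable borel"
    using S(1) by (intro borel_measurable_continuous_on_indicator)
  then have "(\<lambda>y. ennreal (indicator ?S y *\<^sub>R sqrt (det (\<chi> i j. g c y (axis i 1) (axis j 1))))) \<in> borel_measurable borel"
    by measurable
  also have "(\<lambda>y. ennreal (indicator ?S y *\<^sub>R sqrt (det (\<chi> i j. g c y (axis i 1) (axis j 1))))) = (\<lambda>y. ?w y * indicator ?S y)"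
    by (auto simp: indicator_def fun_eq_iff)
  finally have meas: "(\<lambda>y. ?w y * indicator ?S y) \<in> borel_measurable lborel"
    by simp
  have pos: "?w y \<noteq> 0" if "y \<in> ?S" for y
  proof -
    have "0 < ?w y"
      using riemannian_metric_det_pos[OF g c, of y] that S(2) by auto
    then show ?thesis by (rule less_imp_neq[symmetric])
  qed
  have "emeasure \<nu> B = (\<integral>\<^sup>+y. ?w y * indicator ?S y \<partial>lborel)"
    using \<nu> c B by (auto simp: riemannian_volume_def)
  then have "emeasure \<nu> B = 0 \<longleftrightarrow> (AE y in lborel. ?w y * indicator ?S y = 0)"
    using nn_integral_0_iff_AE[OF meas] by simp
  also have "\<dots> \<longleftrightarrow> (AE y in lborel. y \<notin> ?S)"
  proof (rule AE_cong)
    fix y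
    show "(?w y * indicator ?S y = 0) = (y \<notin> ?S)"
      using pos[of y] by (cases "y \<in> ?S") (simp_all only: indicator_simps mult_1_right mult_zero_right simp_thms not_False_eq_True)
  qed
  also have "\<dots> \<longleftrightarrow> ?S \<in> null_sets lborel"
    using S(1) by (intro AE_iff_null_sets[symmetric]) simp
  also have "\<dots> \<longleftrightarrow> negligible ?S"
    using S(1) by (simp add: negligible_iff_null_sets null_sets_completion_iff)
  finally show ?thesis .
qed

lemma diff0_inv: "\<psi> \<in> diff0 A \<Longrightarrow> (inv_into UNIV \<psi>) \<in> diff0 A"
  by (auto simp: diff0_def bij_imp_bij_inv inv_inv_eq) (metis bij_inv_eq_iff)

text \<open>By second countability countably many charts cover the manifold, so a pair of charts can
  be treated at a time. In coordinates the preimage of \<open>N\<close> is an image under the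
  inverse diffeomorphism, and a differentiable map between spaces of equal dimension sends
  negligible sets to negligible sets; no Jacobian has to be computed.\<close>

lemma riemannian_volume_null_vimage:
  fixes A :: "('x::second_countable_topology, real ^ 'n) chart set"
  assumes A: "smooth_atlas A" and g: "riemannian_metric A g" and \<nu>: "riemannian_volume A g \<nu>"
    and \<psi>: "\<psi> \<in> diff0 A" and N: "N \<in> null_sets \<nu>"
  shows "\<psi> -` N \<in> null_sets \<nu>"
proof -
  have sets: "sets \<nu> = sets borel" using \<nu> by (simp add: riemannian_volume_def)
  have Nb: "N \<in> sets borel" using N sets by auto
  have bij: "bij \<psi>" and smooth: "smooth_map A A \<psi>" "smooth_map A A ((inv_into UNIV \<psi>))"
    using \<psi> by (auto simp: diff0_def)
  have \<psi>_meas: "\<psi> \<in> borel_measurable borel"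
    using smooth(1) by (auto simp: smooth_map_def intro: borel_measurable_continuous_onI)
  have chart: "is_chart c" if "c \<in> A" for c
    using A that by (simp add: smooth_atlas_def)
  obtain F where F: "F \<subseteq> fst ` A" "countable F" "\<Union>F = \<Union>(fst ` A)"
    using Lindelof[of "fst ` A"] chart chart_homeomorphism(1) by blast
  obtain C where C: "C \<subseteq> A" "countable C" "F = fst ` C"
    using countable_subset_image[of F fst A] F(1,2) by blast
  have cover: "\<exists>c\<in>C. x \<in> fst c" for x
  proof -
    have "x \<in> \<Union>(fst ` A)" using A by (simp add: smooth_atlas_def)
    then show ?thesis using F(3) C(3) by auto
  qed
  have "fst c \<inter> \<psi> -` (N \<inter> fst d) \<in> null_sets \<nu>" if c: "c \<in> A" and d: "d \<in> A" for c d
  proof -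
    let ?B = "fst c \<inter> \<psi> -` (N \<inter> fst d)"
    let ?f = "snd c \<circ> (inv_into UNIV \<psi>) \<circ> chart_inv d"
    let ?T = "snd d ` (fst d \<inter> (inv_into UNIV \<psi>) -` fst c)" and ?S = "snd d ` (N \<inter> fst d \<inter> (inv_into UNIV \<psi>) -` fst c)"
    note chd = chart_homeomorphism[OF chart[OF d]]
    have Nd: "N \<inter> fst d \<in> sets borel" using Nb chd(1) by auto
    have B: "?B \<in> sets borel"
      using measurable_sets[OF \<psi>_meas Nd] chart_homeomorphism(1)[OF chart[OF c]] by auto
    have "emeasure \<nu> (N \<inter> fst d) = 0"
      using N Nd sets by (metis null_setsD1 null_sets_subset[OF N] inf_le1)
    then have "negligible (snd d ` (N \<inter> fst d))"
      using riemannian_volume_null_iff[OF A g \<nu> d Nd] by simp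
    then have "negligible ?S"
      by (rule negligible_subset) auto
    moreover have "?f differentiable_on ?S"
    proof -
      have "smooth_on ?T ?f"
        using smooth(2) d c by (simp add: smooth_map_def)
      then have "ck_on (Suc 0) ?T ?f" by (simp add: smooth_on_def del: ck_on.simps)
      then have "\<forall>y\<in>?T. ?f differentiable (at y)" by simp
      moreover have "?S \<subseteq> ?T" by auto
      ultimately show ?thesis
        unfolding differentiable_on_def by (blast intro: differentiable_at_withinI)
    qed
    ultimately have "negligible (?f ` ?S)"
      by (intro negligible_differentiable_image_negligible) auto
    moreover have "snd c ` ?B \<subseteq> ?f ` ?S"
    proof
      fix y assume "y \<in> snd c ` ?B"
      then obtain x where x: "x \<in> fst c" "\<psi> x \<in> N" "\<psi> x \<in> fst d" "y = snd c x" by auto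
      then have "(inv_into UNIV \<psi>) (\<psi> x) = x" using bij by (simp add: bij_is_inj)
      with x have "snd d (\<psi> x) \<in> ?S" "?f (snd d (\<psi> x)) = y"
        using chd(5) by auto
      then show "y \<in> ?f ` ?S" by blast
    qed
    ultimately have "negligible (snd c ` ?B)"
      by (rule negligible_subset)
    then have "emeasure \<nu> ?B = 0"
      using riemannian_volume_null_iff[OF A g \<nu> c B] by simp
    then show ?thesis using B sets by auto
  qed
  then have "(\<Union>c\<in>C. \<Union>d\<in>C. fst c \<inter> \<psi> -` (N \<inter> fst d)) \<in> null_sets \<nu>"
    using C(1,2) by (intro null_sets_UN') blast+
  also have "(\<Union>c\<in>C. \<Union>d\<in>C. fst c \<inter> \<psi> -` (N \<inter> fst d)) = \<psi> -` N"
  proof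
    show "\<psi> -` N \<subseteq> (\<Union>c\<in>C. \<Union>d\<in>C. fst c \<inter> \<psi> -` (N \<inter> fst d))"
    proof
      fix x assume "x \<in> \<psi> -` N"
      moreover obtain c where "c \<in> C" "x \<in> fst c" using cover by blast
      moreover obtain d where "d \<in> C" "\<psi> x \<in> fst d" using cover by blast
      ultimately show "x \<in> (\<Union>c\<in>C. \<Union>d\<in>C. fst c \<inter> \<psi> -` (N \<inter> fst d))" by blast
    qed
  qed auto
  finally show ?thesis .
qed

lemma riemannian_volume_null_vimage_iff:
  fixes A :: "('x::second_countable_topology, real ^ 'n) chart set"
  assumes A: "smooth_atlas A" and g: "riemannian_metric A g" and \<nu>: "riemannian_volume A g \<nu>"
    and \<psi>: "\<psi> \<in> diff0 A"
  shows "\<psi> -` N \<in> null_sets \<nu> \<longleftrightarrow> N \<in> null_sets \<nu>"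
proof
  assume "\<psi> -` N \<in> null_sets \<nu>"
  then have "(inv_into UNIV \<psi>) -` (\<psi> -` N) \<in> null_sets \<nu>"
    by (rule riemannian_volume_null_vimage[OF A g \<nu> diff0_inv[OF \<psi>]])
  moreover have "bij \<psi>" using \<psi> by (simp add: diff0_def)
  then have "(inv_into UNIV \<psi>) -` (\<psi> -` N) = N"
    by (auto simp: bij_is_surj surj_f_inv_f)
  ultimately show "N \<in> null_sets \<nu>" by simp
qed (rule riemannian_volume_null_vimage[OF A g \<nu> \<psi>])

section \<open>The action of the semidirect product\<close>

lemma null_sets_pair_iff:
  assumes "sigma_finite_measure M2" "B \<in> sets (M1 \<Otimes>\<^sub>M M2)"
  shows "B \<in> null_sets (M1 \<Otimes>\<^sub>M M2) \<longleftrightarrow> (AE x in M1. emeasure M2 (Pair x -` B) = 0)"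
proof -
  interpret sigma_finite_measure M2 by fact
  have "(\<lambda>x. emeasure M2 (Pair x -` B)) \<in> borel_measurable M1"
    using assms(2) by (rule measurable_emeasure_Pair)
  then show ?thesis
    using assms(2) by (simp add: null_sets_def emeasure_pair_measure_alt nn_integral_0_iff_AE)
qed

text \<open>The section of the preimage over \<open>x\<close> is the \<open>T x\<close>-preimage of
  the section of \<open>B\<close> over \<open>\<psi> x\<close>. Hence the base points with non-null
  section form the \<psi>-preimage of the set \<open>S\<close> belonging to \<open>B\<close>, and
  Fubini reduces both sides to this set.\<close>

lemma null_sets_pair_skew_vimage:
  fixes \<nu> :: "'x::{t2_space, second_countable_topology} measure"
    and \<mu> :: "'m::{t2_space, second_countable_topology} measure"
  assumes \<mu>: "sigma_finite_measure \<mu>" and sets: "sets \<nu> = sets borel" "sets \<mu> = sets borel"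
    and \<psi>: "\<And>N. \<psi> -` N \<in> null_sets \<nu> \<longleftrightarrow> N \<in> null_sets \<nu>" "\<psi> \<in> borel_measurable borel"
    and T: "\<And>x N. N \<in> sets borel \<Longrightarrow> emeasure \<mu> (T x -` N) = 0 \<longleftrightarrow> emeasure \<mu> N = 0"
    and meas: "(\<lambda>(x, m). (\<psi> x, T x m)) \<in> borel_measurable borel" and B: "B \<in> sets borel"
  shows "(\<lambda>(x, m). (\<psi> x, T x m)) -` B \<in> null_sets (\<nu> \<Otimes>\<^sub>M \<mu>) \<longleftrightarrow> B \<in> null_sets (\<nu> \<Otimes>\<^sub>M \<mu>)"
proof -
  have sets_pair: "sets (\<nu> \<Otimes>\<^sub>M \<mu>) = sets borel"
    using sets_pair_measure_cong[OF sets] unfolding borel_prod .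
  let ?a = "\<lambda>(x, m). (\<psi> x, T x m)"
  have aB: "?a -` B \<in> sets borel"
    using measurable_sets[OF meas B] by simp
  have sect: "Pair x -` B \<in> sets borel" for x
    using sets_Pair1[of B \<nu> \<mu> x] B unfolding sets_pair sets .
  define S where "S = {x. emeasure \<mu> (Pair x -` B) \<noteq> 0}"
  have "(\<lambda>x. emeasure \<mu> (Pair x -` B)) \<in> borel_measurable \<nu>"
    using sigma_finite_measure.measurable_emeasure_Pair[OF \<mu>, of B \<nu>] B by (simp add: sets_pair)
  then have "{x \<in> space \<nu>. emeasure \<mu> (Pair x -` B) \<noteq> 0} \<in> sets \<nu>"
    by measurable
  then have S: "S \<in> sets borel"
    using sets_eq_imp_space_eq[OF sets(1)] by (simp add: S_def sets)
  then have \<psi>S: "\<psi> -` S \<in> sets borel"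
    using measurable_sets[OF \<psi>(2) S] by simp
  have "emeasure \<mu> (Pair x -` ?a -` B) = 0 \<longleftrightarrow> x \<notin> \<psi> -` S" for x
  proof -
    have "Pair x -` ?a -` B = T x -` (Pair (\<psi> x) -` B)" by auto
    then show ?thesis
      using T[OF sect, of x "\<psi> x"] by (simp add: S_def)
  qed
  then have "?a -` B \<in> null_sets (\<nu> \<Otimes>\<^sub>M \<mu>) \<longleftrightarrow> (AE x in \<nu>. x \<notin> \<psi> -` S)"
    using null_sets_pair_iff[OF \<mu>, of "?a -` B" \<nu>] aB by (simp add: sets_pair)
  also have "\<dots> \<longleftrightarrow> \<psi> -` S \<in> null_sets \<nu>"
    using \<psi>S by (intro AE_iff_null_sets[symmetric]) (simp add: sets)
  also have "\<dots> \<longleftrightarrow> S \<in> null_sets \<nu>"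
    by (rule \<psi>(1))
  also have "\<dots> \<longleftrightarrow> (AE x in \<nu>. x \<notin> S)"
    using S by (intro AE_iff_null_sets) (simp add: sets)
  also have "\<dots> \<longleftrightarrow> B \<in> null_sets (\<nu> \<Otimes>\<^sub>M \<mu>)"
    using null_sets_pair_iff[OF \<mu>, of B \<nu>] B by (simp add: sets_pair S_def)
  finally show ?thesis .
qed

lemma sigma_finite_radon_measure:
  fixes \<mu> :: "'m::{t2_space, second_countable_topology} measure"
  assumes lc: "locally_compact_space (euclidean :: 'm topology)" and \<mu>: "radon_measure \<mu>"
  shows "sigma_finite_measure \<mu>"
proof
  obtain U :: "nat \<Rightarrow> 'm set" where U: "\<And>n. compact (closure (U n))" "(\<Union>n. U n) = UNIV"
    using relatively_compact_open_cover[OF lc] by auto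
  have sets: "sets \<mu> = sets borel" using \<mu> by (simp add: radon_measure_def)
  let ?A = "range (\<lambda>n. closure (U n))"
  have "\<Union>?A = space \<mu>"
  proof -
    have "(\<Union>n. U n) \<subseteq> \<Union>?A"
      using closure_subset by (intro UN_mono) auto
    then show ?thesis
      using U(2) sets_eq_imp_space_eq[OF sets] by auto
  qed
  moreover have "?A \<subseteq> sets \<mu>"
    by (auto simp: sets)
  moreover have "\<forall>a\<in>?A. emeasure \<mu> a \<noteq> \<infinity>"
  proof
    fix a assume "a \<in> ?A"
    then have "compact a" using U(1) by auto
    then show "emeasure \<mu> a \<noteq> \<infinity>"
      using \<mu> by (metis radon_measure_def less_irrefl)
  qed
  ultimately show "\<exists>A. countable A \<and> A \<subseteq> sets \<mu> \<and> \<Union>A = space \<mu> \<and> (\<forall>a\<in>A. emeasure \<mu> a \<noteq> \<infinity>)"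
    by (intro exI[of _ ?A]) simp
qed

text \<open>\<open>RN_deriv\<close> is fixed only up to null sets, but
  \<open>poisson_transformation\<close> asks for the exact value 1 off a cylinder. Sets disjoint
  from \<open>C\<close> equal their own preimages, so the image measure agrees with \<sigma> there
  and the value may be reset to 1.\<close>

lemma density_image_measure_version:
  assumes \<sigma>: "sigma_finite_measure \<sigma>" and a: "a \<in> \<sigma> \<rightarrow>\<^sub>M \<sigma>" and ac: "absolutely_continuous \<sigma> (distr \<sigma> \<sigma> a)"
    and C: "C \<in> sets \<sigma>" and fixed: "\<And>B. B \<in> sets \<sigma> \<Longrightarrow> B \<inter> C = {} \<Longrightarrow> a -` B \<inter> space \<sigma> = B"
  shows "\<exists>f\<in>borel_measurable \<sigma>. density \<sigma> f = distr \<sigma> \<sigma> a \<and> (\<forall>z. z \<notin> C \<longrightarrow> f z = 1)"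
proof -
  let ?r = "RN_deriv \<sigma> (distr \<sigma> \<sigma> a)"
  define f where "f z = (if z \<in> C then ?r z else 1)" for z
  have f: "f \<in> borel_measurable \<sigma>"
    unfolding f_def using C by measurable
  have dens: "density \<sigma> ?r = distr \<sigma> \<sigma> a"
    using \<sigma> ac by (intro sigma_finite_measure.density_RN_deriv) auto
  have "density \<sigma> f = distr \<sigma> \<sigma> a"
  proof (rule measure_eqI)
    fix B assume "B \<in> sets (density \<sigma> f)"
    then have B: "B \<in> sets \<sigma>" by simp
    have "emeasure (density \<sigma> f) B = (\<integral>\<^sup>+z. f z * indicator B z \<partial>\<sigma>)"
      using f B by (rule emeasure_density)
    also have "\<dots> = (\<integral>\<^sup>+z. ?r z * indicator (B \<inter> C) z + indicator (B - C) z \<partial>\<sigma>)"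
      by (intro nn_integral_cong) (auto simp: f_def indicator_def)
    also have "\<dots> = (\<integral>\<^sup>+z. ?r z * indicator (B \<inter> C) z \<partial>\<sigma>) + emeasure \<sigma> (B - C)"
    proof -
      have "B \<inter> C \<in> sets \<sigma>" "B - C \<in> sets \<sigma>" using B C by auto
      then show ?thesis
        by (simp add: nn_integral_add)
    qed
    also have "(\<integral>\<^sup>+z. ?r z * indicator (B \<inter> C) z \<partial>\<sigma>) = emeasure (distr \<sigma> \<sigma> a) (B \<inter> C)"
    proof -
      have "emeasure (density \<sigma> ?r) (B \<inter> C) = (\<integral>\<^sup>+z. ?r z * indicator (B \<inter> C) z \<partial>\<sigma>)"
        using B C by (intro emeasure_density) auto
      then show ?thesis by (simp only: dens)
    qed
    also have "emeasure \<sigma> (B - C) = emeasure (distr \<sigma> \<sigma> a) (B - C)"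
    proof -
      have D: "B - C \<in> sets \<sigma>" using B C by auto
      then have "a -` (B - C) \<inter> space \<sigma> = B - C" by (rule fixed) auto
      then show ?thesis using emeasure_distr[OF a D] by simp
    qed
    also have "emeasure (distr \<sigma> \<sigma> a) (B \<inter> C) + emeasure (distr \<sigma> \<sigma> a) (B - C) = emeasure (distr \<sigma> \<sigma> a) B"
      using B C by (subst plus_emeasure) (auto simp: Int_Diff_Un)
    finally show "emeasure (density \<sigma> f) B = emeasure (distr \<sigma> \<sigma> a) B" .
  qed simp
  with f show ?thesis
    by (intro bexI[of _ f]) (auto simp: f_def)
qed

text \<open>If \<open>\<psi> x\<close> lies outside \<open>U\<close>, it is a fixed point, and
  injectivity turns \<open>\<psi> (\<psi> x) = \<psi> x\<close> into
  \<open>\<psi> x = x\<close>.\<close>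

lemma vimage_bij_eq:
  assumes "bij \<psi>" "\<And>x. x \<notin> K \<Longrightarrow> \<psi> x = x" "K \<subseteq> U"
  shows "\<psi> -` U = U"
proof -
  have "\<psi> x \<notin> U \<longleftrightarrow> x \<notin> U" for x
  proof
    assume "\<psi> x \<notin> U"
    then have "\<psi> (\<psi> x) = \<psi> x" using assms(2,3) by blast
    then have "\<psi> x = x" using assms(1) by (auto simp: bij_def dest: injD)
    then show "x \<notin> U" using \<open>\<psi> x \<notin> U\<close> by simp
  next
    assume "x \<notin> U"
    then have "\<psi> x = x" using assms(2,3) by blast
    then show "\<psi> x \<notin> U" using \<open>x \<notin> U\<close> by simp
  qed
  then show ?thesis by blast
qed

text \<open>First coordinates are moved by \<open>\<psi>\<close> alone, so they remain distinct.
  Points over a compact set \<open>C\<close> come from points over its preimage, which is compact by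
  continuity of the inverse.\<close>

lemma point_action_marked_configuration:
  fixes \<omega> :: "('x::topological_space \<times> 'm) set"
  assumes "bij \<psi>" "continuous_on UNIV (inv_into UNIV \<psi>)" "\<omega> \<in> marked_configurations"
  shows "point_action \<theta> (\<psi>, \<eta>) ` \<omega> \<in> marked_configurations"
proof -
  let ?a = "point_action \<theta> (\<psi>, \<eta>)"
  have fst_a: "fst (?a z) = \<psi> (fst z)" for z
    by (cases z) (simp add: point_action_def)
  have inj: "inj \<psi>" and surj: "surj \<psi>" using assms(1) by (auto simp: bij_def)
  have "inj_on fst (?a ` \<omega>)"
  proof (rule inj_onI)
    fix z z' assume "z \<in> ?a ` \<omega>" "z' \<in> ?a ` \<omega>" "fst z = fst z'"
    then obtain w w' where w: "w \<in> \<omega>" "w' \<in> \<omega>" "z = ?a w" "z' = ?a w'" "\<psi> (fst w) = \<psi> (fst w')"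
      by (auto simp: fst_a)
    then have "fst w = fst w'" using inj by (simp add: injD)
    then have "w = w'"
      using assms(3) w(1,2) by (auto simp: marked_configurations_def dest: inj_onD)
    then show "z = z'" using w by simp
  qed
  moreover have "finite (fst ` ?a ` \<omega> \<inter> C)" if "compact C" for C
  proof -
    have "compact (inv_into UNIV \<psi> ` C)"
      using that assms(2) by (intro compact_continuous_image) (auto intro: continuous_on_subset)
    then have "finite (\<psi> ` (fst ` \<omega> \<inter> inv_into UNIV \<psi> ` C))"
      using assms(3) by (auto simp: marked_configurations_def)
    moreover have "fst ` ?a ` \<omega> \<inter> C \<subseteq> \<psi> ` (fst ` \<omega> \<inter> inv_into UNIV \<psi> ` C)"
    proof
      fix x assume "x \<in> fst ` ?a ` \<omega> \<inter> C"
      then obtain z where z: "z \<in> \<omega>" "x = \<psi> (fst z)" "x \<in> C"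
        by (auto simp: fst_a)
      then have "inv_into UNIV \<psi> x = fst z" using inj by simp
      then have "fst z \<in> inv_into UNIV \<psi> ` C" using z(3) by (metis image_eqI)
      then show "x \<in> \<psi> ` (fst ` \<omega> \<inter> inv_into UNIV \<psi> ` C)" using z by blast
    qed
    ultimately show ?thesis by (rule finite_subset[rotated])
  qed
  ultimately show ?thesis by (auto simp: marked_configurations_def)
qed

section \<open>From the manifold data to the transformation of Poisson measures\<close>

theorem proposition2p3:
  fixes AX :: "('x::{t2_space, second_countable_topology}, real ^ 'n) chart set"
    and gX :: "('x, real ^ 'n) chart \<Rightarrow> real ^ 'n \<Rightarrow> real ^ 'n \<Rightarrow> real ^ 'n \<Rightarrow> real"
    and \<nu> :: "'x measure"
    and AM :: "('m::{t2_space, second_countable_topology}, 'f::{real_normed_vector, heine_borel}) chart set"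
    and gM :: "('m, 'f) chart \<Rightarrow> 'f \<Rightarrow> 'f \<Rightarrow> 'f \<Rightarrow> real"
    and G :: "'g::t2_space monoid"
    and AG :: "('g, 'h::{real_normed_vector, heine_borel}) chart set"
    and \<theta> :: "'g \<Rightarrow> 'm \<Rightarrow> 'm"
    and lam :: "'m measure"
    and plam :: "'g \<times> 'm \<Rightarrow> real"
    and \<rho> :: "'x \<Rightarrow> real"
    and p :: "'x \<times> 'm \<Rightarrow> real"
    and \<sigma>t :: "('x \<times> 'm) measure"
    and \<pi> :: "('x \<times> 'm) set measure"
  assumes "connected_oriented_riemannian_manifold AX gX"
    and "\<not> compact (UNIV :: 'x set)"
    and "riemannian_volume AX gX \<nu>"
    and "connected_oriented_riemannian_manifold AM gM"
    and "homogeneous_space G AG AM \<theta>"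
    and "radon_measure lam"
    and "quasi_invariant G \<theta> lam"
    and "\<And>g. rn_version lam (distr lam lam (\<theta> g)) (\<lambda>m. ennreal (plam (g, m)))"
    and "differentiable_function (prod_atlas AG AM) plam"
    and "\<rho> \<in> borel_measurable borel"
    and "p \<in> borel_measurable borel"
    and "AE x in \<nu>. 0 < \<rho> x"
    and "radon_measure (density \<nu> (\<lambda>x. ennreal (\<rho> x)))"
    and "nonatomic (density \<nu> (\<lambda>x. ennreal (\<rho> x)))"
    and "AE x in \<nu>. (AE m in lam. 0 < p (x, m)) \<and> (\<integral>\<^sup>+m. ennreal (p (x, m)) \<partial>lam) < \<infinity>"
    and "\<sigma>t = density (\<nu> \<Otimes>\<^sub>M lam) (\<lambda>(x, m). ennreal (\<rho> x * p (x, m)))"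
    and "emeasure \<sigma>t UNIV = \<infinity>"
    and "\<And>\<Lambda>. \<Lambda> \<in> sets borel \<Longrightarrow> compact (closure \<Lambda>) \<Longrightarrow> emeasure \<sigma>t (\<Lambda> \<times> UNIV) < \<infinity>"
    and "marked_poisson_measure \<sigma>t \<pi>"
  shows "quasi_invariant (semidirect_group AX G AG) (configuration_action \<theta>) \<pi> \<and>
    (\<forall>(\<psi>, \<eta>) \<in> carrier (semidirect_group AX G AG). \<forall>K pa.
       compact K \<and> (\<forall>x. x \<notin> K \<longrightarrow> \<psi> x = x \<and> \<eta> x = \<one>\<^bsub>G\<^esub>) \<and>
       rn_version \<sigma>t (distr \<sigma>t \<sigma>t (point_action \<theta> (\<psi>, \<eta>))) pa \<and>
       (\<forall>x m. x \<notin> K \<longrightarrow> pa (x, m) = 1) \<longrightarrow>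
       (AE \<omega> in \<pi>. RN_deriv \<pi> (distr \<pi> \<pi> (configuration_action \<theta> (\<psi>, \<eta>))) \<omega> =
          (\<Prod>z\<in>{z\<in>\<omega>. pa z \<noteq> 1}. pa z)))"
proof -
  have X: "smooth_atlas AX" "riemannian_metric AX gX"
    using assms(1) by (auto simp: connected_oriented_riemannian_manifold_def oriented_atlas_def)
  have M: "smooth_atlas AM"
    using assms(4) by (auto simp: connected_oriented_riemannian_manifold_def oriented_atlas_def)
  have lcX: "locally_compact_space (euclidean :: 'x topology)"
    using X(1) by (rule locally_compact_smooth_manifold)
  have lcM: "locally_compact_space (euclidean :: 'm topology)"
    using M by (rule locally_compact_smooth_manifold)
  have sets: "sets \<nu> = sets borel" "sets lam = sets borel"
    using assms(3,6) by (auto simp: riemannian_volume_def radon_measure_def)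
  have sf_lam: "sigma_finite_measure lam"
    using lcM assms(6) by (rule sigma_finite_radon_measure)
  have sets_pair: "sets (\<nu> \<Otimes>\<^sub>M lam) = sets borel"
    using sets_pair_measure_cong[OF sets] unfolding borel_prod .
  define q where "q = (\<lambda>(x, m). ennreal (\<rho> x * p (x, m)))"
  have \<sigma>t: "\<sigma>t = density (\<nu> \<Otimes>\<^sub>M lam) q"
    using assms(16) by (simp add: q_def)
  have sets_\<sigma>t: "sets \<sigma>t = sets borel"
    by (simp add: \<sigma>t sets_pair)
  interpret P: poisson_configurations \<sigma>t \<pi>
  proof
    show "emeasure \<sigma>t (K \<times> UNIV) < \<infinity>" if "compact K" for K
      using that by (intro assms(18)) (auto simp: borel_compact compact_imp_closed)
  qed (use lcX lcM sets_\<sigma>t assms(19) in auto)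
  have q_eq: "q = (\<lambda>z. ennreal (\<rho> (fst z) * p z))"
    by (auto simp: q_def)
  have "(\<lambda>z. \<rho> (fst z)) \<in> borel_measurable (borel :: ('x \<times> 'm) measure)"
    using assms(10) by (rule measurable_compose[rotated]) (simp add: borel_prod[symmetric])
  then have q: "q \<in> borel_measurable borel"
    unfolding q_eq using assms(11) by measurable
  \<comment> \<open>Positivity almost everywhere makes the null sets of \<open>\<sigma>t\<close>
    those of the product measure, where the Fubini argument is available.\<close>
  have q_pos: "AE z in \<nu> \<Otimes>\<^sub>M lam. q z \<noteq> 0"
  proof -
    let ?N = "{z. q z = 0}"
    have "{z \<in> space borel. q z = 0} \<in> sets borel"
      using q by measurable
    then have N: "?N \<in> sets (\<nu> \<Otimes>\<^sub>M lam)"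
      by (simp add: sets_pair)
    have "AE x in \<nu>. emeasure lam (Pair x -` ?N) = 0"
      using assms(12,15)
    proof eventually_elim
      case (elim x)
      then have "AE m in lam. m \<notin> Pair x -` ?N"
        by (auto simp: q_def ennreal_eq_0_iff not_le elim!: eventually_mono)
      then show ?case
        using sets_Pair1[OF N, of x] by (subst (asm) AE_iff_null_sets[symmetric]) auto
    qed
    then have "?N \<in> null_sets (\<nu> \<Otimes>\<^sub>M lam)"
      using null_sets_pair_iff[OF sf_lam N] by simp
    then show ?thesis
      using AE_iff_null_sets[OF N] by simp
  qed
  have null_\<sigma>t: "B \<in> null_sets \<sigma>t \<longleftrightarrow> B \<in> null_sets (\<nu> \<Otimes>\<^sub>M lam)" for B
  proof -
    have "q \<in> borel_measurable (\<nu> \<Otimes>\<^sub>M lam)"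
      using q by (simp add: measurable_cong_sets[OF sets_pair refl])
    then have "B \<in> null_sets \<sigma>t \<longleftrightarrow> B \<in> sets (\<nu> \<Otimes>\<^sub>M lam) \<and> (AE z in \<nu> \<Otimes>\<^sub>M lam. z \<in> B \<longrightarrow> q z = 0)"
      unfolding \<sigma>t by (rule null_sets_density_iff)
    also have "(AE z in \<nu> \<Otimes>\<^sub>M lam. z \<in> B \<longrightarrow> q z = 0) \<longleftrightarrow> (AE z in \<nu> \<Otimes>\<^sub>M lam. z \<notin> B)"
    proof
      assume "AE z in \<nu> \<Otimes>\<^sub>M lam. z \<in> B \<longrightarrow> q z = 0"
      with q_pos show "AE z in \<nu> \<Otimes>\<^sub>M lam. z \<notin> B" by eventually_elim auto
    qed (auto elim: eventually_mono)
    finally show ?thesis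
      by (metis AE_iff_null_sets null_setsD2)
  qed
  have lie: "carrier G = UNIV" "group_action G UNIV \<theta>" "continuous_on UNIV (\<lambda>(g, m). \<theta> g m)"
    using assms(5) by (auto simp: homogeneous_space_def lie_group_def smooth_map_def transitive_action_def)
  have \<theta>_one: "\<theta> \<one>\<^bsub>G\<^esub> m = m" for m
    using group_action.id_eq_one[OF lie(2)] by (metis UNIV_I restrict_apply)
  have \<theta>_null: "emeasure lam (\<theta> g -` N) = 0 \<longleftrightarrow> emeasure lam N = 0" if N: "N \<in> sets borel" for g N
  proof -
    have \<theta>: "\<theta> g \<in> lam \<rightarrow>\<^sub>M lam" "absolutely_continuous lam (distr lam lam (\<theta> g))"
      "absolutely_continuous (distr lam lam (\<theta> g)) lam"
      using assms(7) lie(1) by (auto simp: quasi_invariant_def)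
    have "emeasure (distr lam lam (\<theta> g)) N = emeasure lam (\<theta> g -` N)"
      using N sets_eq_imp_space_eq[OF sets(2)] by (subst emeasure_distr[OF \<theta>(1)]) (auto simp: sets)
    moreover have "N \<in> null_sets (distr lam lam (\<theta> g)) \<longleftrightarrow> N \<in> null_sets lam"
      using \<theta>(2,3) by (auto simp: absolutely_continuous_def)
    ultimately show ?thesis
      using N by (simp add: null_sets_def sets)
  qed
  \<comment> \<open>The first three facts are the quasi-invariance of \<open>\<sigma>t\<close> under
    one group element. The fourth leaves \<open>pa\<close> open: quasi-invariance needs a
    constructed version, the product formula the given one.\<close>
  have step: "point_action \<theta> (\<psi>, \<eta>) \<in> \<sigma>t \<rightarrow>\<^sub>M \<sigma>t"
    "absolutely_continuous \<sigma>t (distr \<sigma>t \<sigma>t (point_action \<theta> (\<psi>, \<eta>)))"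
    "absolutely_continuous (distr \<sigma>t \<sigma>t (point_action \<theta> (\<psi>, \<eta>))) \<sigma>t"
    "\<And>K pa. compact K \<Longrightarrow> (\<And>x. x \<notin> K \<Longrightarrow> \<psi> x = x) \<Longrightarrow> pa \<in> borel_measurable borel \<Longrightarrow>
       density \<sigma>t pa = distr \<sigma>t \<sigma>t (point_action \<theta> (\<psi>, \<eta>)) \<Longrightarrow> (\<And>z. fst z \<notin> K \<Longrightarrow> pa z = 1) \<Longrightarrow>
       poisson_transformation \<sigma>t \<pi> (point_action \<theta> (\<psi>, \<eta>)) K pa"
    if car: "(\<psi>, \<eta>) \<in> carrier (semidirect_group AX G AG)" for \<psi> \<eta>
  proof -
    let ?a = "point_action \<theta> (\<psi>, \<eta>)"
    have \<psi>: "\<psi> \<in> diff0 AX" and \<eta>: "\<eta> \<in> gauge_maps AX G AG"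
      using car by (auto simp: semidirect_group_def)
    have bij: "bij \<psi>" and cont: "continuous_on UNIV \<psi>" "continuous_on UNIV (inv_into UNIV \<psi>)" "continuous_on UNIV \<eta>"
      using \<psi> \<eta> by (auto simp: diff0_def gauge_maps_def smooth_map_def)
    have a_eq: "?a = (\<lambda>(x, m). (\<psi> x, \<theta> (\<eta> (\<psi> x)) m))"
      by (simp add: point_action_def)
    have c\<eta>: "continuous_on UNIV (\<lambda>z::'x \<times> 'm. \<eta> (\<psi> (fst z)))"
      by (intro continuous_on_compose2[OF cont(3)] continuous_on_compose2[OF cont(1)] continuous_intros) auto
    have "continuous_on UNIV (\<lambda>z. (\<lambda>(g, m). \<theta> g m) (\<eta> (\<psi> (fst z)), snd z))"
      by (rule continuous_on_compose2[OF lie(3)]) (auto intro!: continuous_on_Pair c\<eta> continuous_intros)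
    then have "continuous_on UNIV (\<lambda>z. (\<psi> (fst z), \<theta> (\<eta> (\<psi> (fst z))) (snd z)))"
      by (intro continuous_on_Pair continuous_on_compose2[OF cont(1)] continuous_intros) auto
    then have a_cont: "continuous_on UNIV ?a"
      by (simp add: a_eq case_prod_unfold)
    then have a_meas: "?a \<in> borel_measurable borel"
      by (rule borel_measurable_continuous_onI)
    then show a_meas': "?a \<in> \<sigma>t \<rightarrow>\<^sub>M \<sigma>t"
      by (simp add: measurable_cong_sets[OF sets_\<sigma>t sets_\<sigma>t])
    \<comment> \<open>The action is a skew product: \<open>\<psi>\<close> on the base and, over each
      \<open>x\<close>, the single map \<open>\<theta> (\<eta> (\<psi> x))\<close> on the
      fibre.\<close>
    have null_a: "?a -` B \<in> null_sets \<sigma>t \<longleftrightarrow> B \<in> null_sets \<sigma>t" if "B \<in> sets borel" for B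
      unfolding null_\<sigma>t a_eq
    proof (rule null_sets_pair_skew_vimage[OF sf_lam sets])
      show "\<psi> -` N \<in> null_sets \<nu> \<longleftrightarrow> N \<in> null_sets \<nu>" for N
        by (rule riemannian_volume_null_vimage_iff[OF X assms(3) \<psi>])
      show "\<psi> \<in> borel_measurable borel"
        using cont(1) by (rule borel_measurable_continuous_onI)
    qed (use \<theta>_null a_meas that in \<open>auto simp: a_eq\<close>)
    have null_distr: "B \<in> null_sets (distr \<sigma>t \<sigma>t ?a) \<longleftrightarrow> B \<in> null_sets \<sigma>t" for B
    proof (cases "B \<in> sets borel")
      case True
      have "B \<in> null_sets (distr \<sigma>t \<sigma>t ?a) \<longleftrightarrow> ?a -` B \<in> null_sets \<sigma>t"
        using True a_meas' measurable_sets[OF a_meas True]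
        by (simp add: null_sets_def emeasure_distr sets_\<sigma>t P.space_intensity)
      then show ?thesis using null_a[OF True] by simp
    qed (auto simp: null_sets_def sets_\<sigma>t)
    then show "absolutely_continuous \<sigma>t (distr \<sigma>t \<sigma>t ?a)" "absolutely_continuous (distr \<sigma>t \<sigma>t ?a) \<sigma>t"
      by (auto simp: absolutely_continuous_def)
    show "poisson_transformation \<sigma>t \<pi> ?a K pa"
      if K: "compact K" "\<And>x. x \<notin> K \<Longrightarrow> \<psi> x = x"
        and pa: "pa \<in> borel_measurable borel" "density \<sigma>t pa = distr \<sigma>t \<sigma>t ?a" "\<And>z. fst z \<notin> K \<Longrightarrow> pa z = 1" for K pa
    proof
      show "?a -` (U \<times> UNIV) = U \<times> UNIV" if "K \<subseteq> U" for U
      proof -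
        have "\<psi> -` U = U" using bij K(2) that by (rule vimage_bij_eq)
        then show ?thesis by (auto simp: a_eq)
      qed
      show "?a ` \<omega> \<in> marked_configurations" if "\<omega> \<in> marked_configurations" for \<omega> :: "('x \<times> 'm) set"
        using bij cont(2) that by (rule point_action_marked_configuration)
    qed (use K pa a_meas in auto)
  qed
  have conf: "configuration_action \<theta> (\<psi>, \<eta>) = (`) (point_action \<theta> (\<psi>, \<eta>))" for \<psi> \<eta>
    by (simp add: configuration_action_def fun_eq_iff)
  have "configuration_action \<theta> (\<psi>, \<eta>) \<in> \<pi> \<rightarrow>\<^sub>M \<pi> \<and>
      absolutely_continuous \<pi> (distr \<pi> \<pi> (configuration_action \<theta> (\<psi>, \<eta>))) \<and>
      absolutely_continuous (distr \<pi> \<pi> (configuration_action \<theta> (\<psi>, \<eta>))) \<pi>"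
    if car: "(\<psi>, \<eta>) \<in> carrier (semidirect_group AX G AG)" for \<psi> \<eta>
  proof -
    let ?a = "point_action \<theta> (\<psi>, \<eta>)"
    obtain K1 K2 where K12: "compact K1" "\<And>x. x \<notin> K1 \<Longrightarrow> \<psi> x = x" "compact K2" "\<And>x. x \<notin> K2 \<Longrightarrow> \<eta> x = \<one>\<^bsub>G\<^esub>"
      and bij: "bij \<psi>"
      using car by (auto simp: semidirect_group_def diff0_def gauge_maps_def)
    \<comment> \<open>The action is trivial only where both components are, hence the union of the
      two supports.\<close>
    define K where "K = K1 \<union> K2"
    have K: "compact K" "\<And>x. x \<notin> K \<Longrightarrow> \<psi> x = x" "\<And>x. x \<notin> K \<Longrightarrow> \<eta> x = \<one>\<^bsub>G\<^esub>"
      using K12 by (auto simp: K_def)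
    \<comment> \<open>Needed so that no point over \<open>K\<close> is moved into a set disjoint
      from the cylinder over \<open>K\<close>; the preimage of such a set would otherwise gain
      points.\<close>
    have \<psi>K: "\<psi> -` K = K"
      using bij K(2) order_refl by (rule vimage_bij_eq)
    have fixed: "?a -` B = B" if B: "B \<inter> K \<times> UNIV = {}" for B
    proof -
      have "?a z \<in> B \<longleftrightarrow> z \<in> B" for z
      proof (cases "fst z \<in> K")
        case True
        then have "\<psi> (fst z) \<in> K" using \<psi>K by blast
        with True B show ?thesis
          by (cases z) (auto simp: point_action_def)
      next
        case False
        then have "?a z = z"
          using K(2,3) by (cases z) (simp add: point_action_def \<theta>_one)
        then show ?thesis by simp
      qed
      then show ?thesis by blast
    qed
    have "\<exists>f\<in>borel_measurable \<sigma>t. density \<sigma>t f = distr \<sigma>t \<sigma>t ?a \<and> (\<forall>z. z \<notin> K \<times> UNIV \<longrightarrow> f z = 1)"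
    proof (rule density_image_measure_version[OF P.sigma_finite_intensity step(1,2)[OF car]])
      show "K \<times> UNIV \<in> sets \<sigma>t"
        using K(1) by (simp add: sets_\<sigma>t borel_closed closed_Times compact_imp_closed)
      show "?a -` B \<inter> space \<sigma>t = B" if "B \<in> sets \<sigma>t" "B \<inter> K \<times> UNIV = {}" for B
        using fixed[OF that(2)] by (simp add: P.space_intensity)
    qed
    then obtain pa where pa: "pa \<in> borel_measurable borel" "density \<sigma>t pa = distr \<sigma>t \<sigma>t ?a"
      "\<And>z. z \<notin> K \<times> UNIV \<Longrightarrow> pa z = 1"
      by (auto simp: measurable_cong_sets[OF sets_\<sigma>t refl])
    interpret T: poisson_transformation \<sigma>t \<pi> ?a K pa
      using pa by (intro step(4)[OF car K(1,2)]) (auto simp: mem_Times_iff)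
    show ?thesis
      unfolding conf using T.image_measurable T.quasi_invariant_poisson[OF step(3)[OF car]] by blast
  qed
  then have "quasi_invariant (semidirect_group AX G AG) (configuration_action \<theta>) \<pi>"
    unfolding quasi_invariant_def by (metis surj_pair)
  moreover have "AE \<omega> in \<pi>. RN_deriv \<pi> (distr \<pi> \<pi> (configuration_action \<theta> (\<psi>, \<eta>))) \<omega> =
          (\<Prod>z\<in>{z\<in>\<omega>. pa z \<noteq> 1}. pa z)"
    if car: "(\<psi>, \<eta>) \<in> carrier (semidirect_group AX G AG)"
      and K: "compact K" "\<forall>x. x \<notin> K \<longrightarrow> \<psi> x = x \<and> \<eta> x = \<one>\<^bsub>G\<^esub>"
      and pa: "rn_version \<sigma>t (distr \<sigma>t \<sigma>t (point_action \<theta> (\<psi>, \<eta>))) pa" "\<forall>x m. x \<notin> K \<longrightarrow> pa (x, m) = 1"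
    for \<psi> \<eta> K pa
  proof -
    let ?a = "point_action \<theta> (\<psi>, \<eta>)"
    have pa_meas: "pa \<in> borel_measurable \<sigma>t" and pa_eq: "AE z in \<sigma>t. pa z = RN_deriv \<sigma>t (distr \<sigma>t \<sigma>t ?a) z"
      using pa(1) by (auto simp: rn_version_def)
    \<comment> \<open>All versions define the same measure, so the given \<open>pa\<close> satisfies
      the hypotheses of the locale.\<close>
    have "density \<sigma>t pa = density \<sigma>t (RN_deriv \<sigma>t (distr \<sigma>t \<sigma>t ?a))"
      using pa_meas pa_eq by (intro density_cong) auto
    also have "\<dots> = distr \<sigma>t \<sigma>t ?a"
      using P.sigma_finite_intensity step(2)[OF car] by (intro sigma_finite_measure.density_RN_deriv) auto
    finally have dens: "density \<sigma>t pa = distr \<sigma>t \<sigma>t ?a" .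
    interpret T: poisson_transformation \<sigma>t \<pi> ?a K pa
    proof (rule step(4)[OF car K(1) _ _ dens])
      show "pa \<in> borel_measurable borel"
        using pa_meas by (simp add: measurable_cong_sets[OF sets_\<sigma>t refl])
      show "pa z = 1" if "fst z \<notin> K" for z
        using pa(2) that by (cases z) auto
    qed (use K(2) in auto)
    show ?thesis
      unfolding conf by (rule T.RN_deriv_poisson)
  qed
  ultimately show ?thesis by blast
qed

end
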